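(* Let $\phi(z)=1+\sum_{n=1}^\infty B_nz^n$ be a Ma-Minda function with $B_n>0$ for all $n\ge1$ and such that $\min_{|z|=r}|\phi(z)|=\phi(-r)$ and $\max_{|z|=r}|\phi(z)|=\phi(r)$ for all $0<r<1$. Let $h$ be the analytic function in $\mathbb{D}$ with $zh'(z)/h(z)=\phi(z)$, $h(0)=h'(0)-1=0$. Then each $f(z)=z+\sum_{n=2}^\infty a_nz^n\in\mathcal{S}^*_c(\phi)$ satisfies $$|z|+\sum_{n=2}^\infty|a_n||z|^n\le d(f(0),\partial f(\mathbb{D}))$$ for $|z|\le\min\{1/3,r_f\}$, where $r_f$ is the root in $(0,1)$ of the equation $h(r)+h(-1)=0$. Moreover, when $r_f\le1/3$, the radius $r_f$ is best possible, i.e. it cannot be replaced by any larger number so that the inequality remains true for all $f\in\mathcal{S}^*_c(\phi)$ (the function $f=h\in\mathcal{S}^*_c(\phi)$ being extremal).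
   Context: $\mathbb{D}=\{z\in\mathbb{C}:|z|<1\}$ and $\mathcal{A}$ is the class of analytic functions $f$ in $\mathbb{D}$ of the form $f(z)=z+\sum_{n\ge2}a_nz^n$. $d$ is Euclidean distance, $d(f(0),\partial f(\mathbb{D}))$ being the distance from $f(0)$ to the boundary of $f(\mathbb{D})$. For analytic $f,g$ in $\mathbb{D}$, $f\prec g$ means $f=g\circ\omega$ for some analytic $\omega:\mathbb{D}\to\mathbb{D}$ with $\omega(0)=0$. A Ma-Minda function is an analytic univalent function $\phi:\mathbb{D}\to\mathbb{C}$ such that $\phi(\mathbb{D})$ lies in the right half-plane $\{\mathrm{Re}\,w>0\}$, is symmetric with respect to the real axis and starlike with respect to $\phi(0)=1$, and $\phi'(0)>0$. $\mathcal{S}^*_c(\phi)$ is the class of $f\in\mathcal{A}$ with $\dfrac{2zf'(z)}{f(z)+\overline{f(\bar z)}}\prec\phi(z)$ in $\mathbb{D}$. The value $h(-1)$ denotes $\lim_{r\to1^-}h(-r)$. *)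

theory Defs
  imports "HOL-Complex_Analysis.Complex_Analysis"
begin

abbreviation unit_disc :: "complex set" where
  "unit_disc \<equiv> ball 0 1"

abbreviation taylor_coeff :: "(complex \<Rightarrow> complex) \<Rightarrow> nat \<Rightarrow> complex" where
  "taylor_coeff f n \<equiv> fps_nth (fps_expansion f 0) n"

definition class_A :: "(complex \<Rightarrow> complex) set" where
  "class_A = {f. f holomorphic_on unit_disc \<and> f 0 = 0 \<and> deriv f 0 = 1}"

definition subordinate :: "(complex \<Rightarrow> complex) \<Rightarrow> (complex \<Rightarrow> complex) \<Rightarrow> bool" where
  "subordinate f g \<longleftrightarrow>
     f holomorphic_on unit_disc \<and> g holomorphic_on unit_disc \<and>
     (\<exists>\<omega>. \<omega> holomorphic_on unit_disc \<and> \<omega> ` unit_disc \<subseteq> unit_disc \<and> \<omega> 0 = 0 \<and>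
          (\<forall>z\<in>unit_disc. f z = g (\<omega> z)))"

definition ma_minda :: "(complex \<Rightarrow> complex) \<Rightarrow> bool" where
  "ma_minda \<phi> \<longleftrightarrow>
     \<phi> holomorphic_on unit_disc \<and> inj_on \<phi> unit_disc \<and>
     \<phi> ` unit_disc \<subseteq> {w. Re w > 0} \<and>
     cnj ` (\<phi> ` unit_disc) = \<phi> ` unit_disc \<and>
     \<phi> 0 = 1 \<and>
     (\<forall>w \<in> \<phi> ` unit_disc. closed_segment (\<phi> 0) w \<subseteq> \<phi> ` unit_disc) \<and>
     deriv \<phi> 0 \<in> \<real> \<and> Re (deriv \<phi> 0) > 0"

(* The quotient 2zf'(z)/(f(z)+cnj(f(cnj z))) has a removable singularity at 0 with value 1
   for f in class_A. At the other points a vanishing denominator would give the value 0, which is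
   not a value of a Ma-Minda function, so subordination rules it out. *)
definition conj_quotient :: "(complex \<Rightarrow> complex) \<Rightarrow> complex \<Rightarrow> complex" where
  "conj_quotient f z = (if z = 0 then 1 else 2 * z * deriv f z / (f z + cnj (f (cnj z))))"

definition starlike_conj :: "(complex \<Rightarrow> complex) \<Rightarrow> (complex \<Rightarrow> complex) set" where
  "starlike_conj \<phi> = {f \<in> class_A. subordinate (conj_quotient f) \<phi>}"

(* h is determined by phi on the unit disc only. The equation is required off 0: its left-hand
   side tends to 1 = phi 0 at 0, whereas 0/0 = 0 in HOL. *)
definition ma_minda_extremal :: "(complex \<Rightarrow> complex) \<Rightarrow> (complex \<Rightarrow> complex) \<Rightarrow> bool" where
  "ma_minda_extremal \<phi> h \<longleftrightarrow>
     h holomorphic_on unit_disc \<and> h 0 = 0 \<and> deriv h 0 = 1 \<and>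
     (\<forall>z \<in> unit_disc - {0}. h z \<noteq> 0 \<and> z * deriv h z / h z = \<phi> z)"

definition value_at_minus_one :: "(complex \<Rightarrow> complex) \<Rightarrow> complex" where
  "value_at_minus_one h = Lim (at_left 1) (\<lambda>r::real. h (- complex_of_real r))"

definition is_bohr_root :: "(complex \<Rightarrow> complex) \<Rightarrow> real \<Rightarrow> bool" where
  "is_bohr_root h r \<longleftrightarrow>
     0 < r \<and> r < 1 \<and> h (complex_of_real r) + value_at_minus_one h = 0"

definition bohr_radius :: "(complex \<Rightarrow> complex) \<Rightarrow> real" where
  "bohr_radius h = (THE r. is_bohr_root h r)"

definition bohr_sum :: "(complex \<Rightarrow> complex) \<Rightarrow> complex \<Rightarrow> real" where
  "bohr_sum f z = norm z + (\<Sum>n. norm (taylor_coeff f (n + 2)) * norm z ^ (n + 2))"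

(* The image of the disc is never the whole plane for the functions considered (they are
   univalent), so its frontier is nonempty and infdist is the genuine distance. *)
definition boundary_dist :: "(complex \<Rightarrow> complex) \<Rightarrow> real" where
  "boundary_dist f = infdist (f 0) (frontier (f ` unit_disc))"

end

theory Submission
  imports Defs
begin

text \<open>
  Let \<open>f \<in> starlike_conj \<phi>\<close>, let \<open>g z = (f z + cnj (f (cnj z))) / 2\<close>, and write \<open>z f' = g p\<close> with
  \<open>p = \<phi> \<circ> \<omega>\<close> for a Schwarz function \<open>\<omega>\<close>. Put \<open>r = norm z\<close> and \<open>L = - h (-1)\<close>. For \<open>r \<le> 1/3\<close> the
  proof establishes
    \<open>bohr_sum f z \<le> h r\<close> and \<open>L \<le> boundary_dist f\<close>.
  Since \<open>h\<close> increases on \<open>[0, 1)\<close> and \<open>h r_f = L\<close>, both together give the inequality for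
  \<open>r \<le> min (1/3) r_f\<close>. For \<open>f = h\<close> the Taylor coefficients are nonnegative, so \<open>bohr_sum h z = h r\<close>,
  and \<open>- L\<close> is a frontier point of the image, so \<open>boundary_dist h = L\<close>; this gives equality at \<open>r_f\<close>
  and failure beyond it.
  
  Upper estimate. Bohr's theorem for \<open>\<omega> z / z\<close> bounds the majorant series of \<open>\<omega>\<close> by \<open>r\<close>, hence that of
  \<open>p\<close> by \<open>\<phi> r\<close> (\<open>majorant_Schwarz_function_le\<close>, \<open>majorant_compose_le\<close>). Comparing coefficients in
  \<open>z f' = g p\<close> gives a differential inequality for the majorant series of \<open>f\<close>, of which \<open>h\<close> solves the
  equality case (\<open>partial_sum_le_exp\<close>, \<open>partial_majorant_le_H\<close>).
  
  Lower estimate. The logarithmic derivative \<open>z g' / g\<close> is the mean of \<open>p\<close> and its reflection. Integrating,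
  \<open>log (g z / z)\<close> is the mean of a primitive of \<open>(p - 1) / z\<close> and its reflection, and the real part of that
  primitive is at least its value for \<open>p = \<phi>\<close> at \<open>- r\<close> (\<open>Re_log_primitive_subordinate_ge\<close>). So
  \<open>norm (g z) \<ge> - h (- r)\<close> and \<open>norm (f' z) \<ge> h' (- r)\<close>. Moreover \<open>f\<close> is close to convex with respect to
  the starlike function \<open>g\<close>, hence univalent (\<open>close_to_convex_inj_on\<close>), and integrating the lower bound
  on the derivative along the preimage of a segment shows that the image covers every disc of radius
  \<open>- h (- \<rho>)\<close> with \<open>\<rho> < 1\<close> (\<open>boundary_dist_ge_of_deriv_ge\<close>).
\<close>

section \<open>Univalence of close-to-convex functions\<close>

text \<open>
  The equation \<open>F z' + \<delta> g z' = F z\<close> says that the quotient \<open>\<Phi> = (F - F z) / g\<close> takes the value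
  \<open>- \<delta>\<close> at \<open>z'\<close>. Since \<open>z \<Phi>'(z) = z F'(z) / g(z)\<close> has positive real part, \<open>\<Phi>\<close> has a local inverse,
  and along the negative real axis this inverse starts with velocity \<open>-1 / \<Phi>'(z)\<close>, which points
  towards the origin. So the root moves inwards as \<open>\<delta>\<close> grows from \<open>0\<close>.
\<close>
lemma solution_moves_inward:
  fixes F g :: "complex \<Rightarrow> complex"
  assumes holF: "F holomorphic_on D" and holg: "g holomorphic_on D" and D: "open D" "z \<in> D"
    and gz: "g z \<noteq> 0" and pos: "Re (z * deriv F z / g z) > 0" and \<eta>: "\<eta> > 0"
  obtains e where "e > 0"
    "\<And>\<delta>::real. 0 < \<delta> \<Longrightarrow> \<delta> < e \<Longrightarrow>
       \<exists>z'\<in>ball z \<eta> \<inter> D. norm z' < norm z \<and> F z' + of_real \<delta> * g z' = F z"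
proof -
  define U where "U = D \<inter> g -` (-{0})"
  have openU: "open U"
    unfolding U_def using continuous_open_preimage[OF holomorphic_on_imp_continuous_on[OF holg] D(1)] by auto
  have zU: "z \<in> U" using D gz by (auto simp: U_def)
  define \<Phi> where "\<Phi> = (\<lambda>u. (F u - F z) / g u)"
  have hol\<Phi>: "\<Phi> holomorphic_on U"
    unfolding \<Phi>_def using holF holg by (auto intro!: holomorphic_intros simp: U_def holomorphic_on_subset)
  define c where "c = deriv F z / g z"
  have c: "Re (z * c) > 0" using pos by (simp add: c_def)
  have "c \<noteq> 0" using c by auto
  have dF: "(F has_field_derivative deriv F z) (at z)" and dg: "(g has_field_derivative deriv g z) (at z)"
    using holomorphic_derivI[OF holF D] holomorphic_derivI[OF holg D] by auto
  have d\<Phi>: "(\<Phi> has_field_derivative c) (at z)"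
    unfolding \<Phi>_def c_def using gz
    by (auto intro!: derivative_eq_intros dF dg simp: field_simps)
  then have dn: "deriv \<Phi> z \<noteq> 0" using \<open>c \<noteq> 0\<close> by (simp add: DERIV_imp_deriv)
  obtain r where r: "r > 0" "ball z r \<subseteq> U" "inj_on \<Phi> (ball z r)"
    using has_complex_derivative_locally_invertible[OF hol\<Phi> zU openU dn] by metis
  \<comment> \<open>Shrinking the ball to radius at most \<open>\<eta>\<close> keeps the new root near \<open>z\<close>.\<close>
  define s where "s = min r \<eta>"
  have s: "s > 0" "ball z s \<subseteq> U" "inj_on \<Phi> (ball z s)" "z \<in> ball z s"
    using r \<eta> by (auto simp: s_def intro: inj_on_subset)
  obtain \<Psi> where \<Psi>: "\<Psi> holomorphic_on \<Phi> ` ball z s"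
      "\<And>x. x \<in> ball z s \<Longrightarrow> deriv \<Phi> x * deriv \<Psi> (\<Phi> x) = 1" "\<And>x. x \<in> ball z s \<Longrightarrow> \<Psi> (\<Phi> x) = x"
    using holomorphic_has_inverse[OF holomorphic_on_subset[OF hol\<Phi> s(2)] open_ball s(3)] by metis
  have opI: "open (\<Phi> ` ball z s)"
    using open_mapping_thm3[OF holomorphic_on_subset[OF hol\<Phi> s(2)] open_ball s(3)] .
  have \<Phi>z: "\<Phi> z = 0" by (simp add: \<Phi>_def)
  have zero_in: "0 \<in> \<Phi> ` ball z s" using s(4) \<Phi>z by (metis imageI)
  obtain e0 where e0: "e0 > 0" "ball 0 e0 \<subseteq> \<Phi> ` ball z s"
    using opI zero_in by (auto simp: open_contains_ball)
  have "deriv \<Psi> 0 = 1 / c"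
    using \<Psi>(2)[OF s(4)] \<Phi>z d\<Phi> \<open>c \<noteq> 0\<close> by (simp add: DERIV_imp_deriv field_simps)
  then have d\<Psi>: "(\<Psi> has_field_derivative 1 / c) (at 0)"
    using holomorphic_derivI[OF \<Psi>(1) opI zero_in] by simp
  have \<Psi>0: "\<Psi> 0 = z" using \<Psi>(3)[OF s(4)] \<Phi>z by simp
  have "((\<lambda>\<delta>::real. - complex_of_real \<delta>) has_vector_derivative -1) (at 0)"
    by (auto intro!: derivative_eq_intros simp: scaleR_conv_of_real)
  then have "((\<Psi> \<circ> (\<lambda>\<delta>::real. - complex_of_real \<delta>)) has_vector_derivative -1 * (1 / c)) (at 0)"
    by (rule field_vector_diff_chain_at) (use d\<Psi> in simp)
  then have dk: "((\<lambda>\<delta>::real. \<Psi> (- complex_of_real \<delta>)) has_vector_derivative - (1 / c)) (at 0)"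
    by (simp add: o_def)
  then have dRe: "((\<lambda>\<delta>. Re (\<Psi> (- complex_of_real \<delta>))) has_real_derivative Re (- (1 / c))) (at 0)"
    and dIm: "((\<lambda>\<delta>. Im (\<Psi> (- complex_of_real \<delta>))) has_real_derivative Im (- (1 / c))) (at 0)"
    by (simp_all only: has_vector_derivative_complex_iff)
  have "((\<lambda>\<delta>. (Re (\<Psi> (- complex_of_real \<delta>)))\<^sup>2 + (Im (\<Psi> (- complex_of_real \<delta>)))\<^sup>2)
      has_real_derivative 2 * Re z * Re (- (1 / c)) + 2 * Im z * Im (-(1 / c))) (at 0)"
    by (rule derivative_eq_intros dRe dIm refl)+ (simp add: \<Psi>0)
  then have dN: "((\<lambda>\<delta>. (norm (\<Psi> (- complex_of_real \<delta>)))\<^sup>2)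
      has_real_derivative 2 * Re z * Re (- (1 / c)) + 2 * Im z * Im (-(1 / c))) (at 0)"
    by (simp add: cmod_power2)
  have "2 * Re z * Re (- (1 / c)) + 2 * Im z * Im (-(1 / c)) = - 2 * Re (z * c) / (norm c)\<^sup>2"
    by (simp add: Re_divide Im_divide cmod_power2 diff_divide_distrib right_diff_distrib)
  moreover have "\<dots> < 0" using c \<open>c \<noteq> 0\<close> by (intro divide_neg_pos) auto
  ultimately obtain e1 where e1: "e1 > 0" "\<And>h. h > 0 \<Longrightarrow> h < e1 \<Longrightarrow>
      (norm (\<Psi> (- complex_of_real 0)))\<^sup>2 > (norm (\<Psi> (- complex_of_real (0 + h))))\<^sup>2"
    using DERIV_neg_dec_right[OF dN] by auto
  show ?thesis
  proof (rule that[of "min e0 e1"])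
    show "min e0 e1 > 0" using e0 e1 by simp
    fix \<delta> :: real assume \<delta>: "0 < \<delta>" "\<delta> < min e0 e1"
    have "- complex_of_real \<delta> \<in> \<Phi> ` ball z s" by (rule subsetD[OF e0(2)]) (use \<delta> in simp)
    then obtain x where x: "x \<in> ball z s" "\<Phi> x = - complex_of_real \<delta>" by auto
    have "\<Psi> (- complex_of_real \<delta>) = x" using \<Psi>(3)[OF x(1)] x(2) by simp
    then have "(norm x)\<^sup>2 < (norm z)\<^sup>2" using e1(2)[of \<delta>] \<delta> \<Psi>0 by simp
    then have "norm x < norm z" by (simp add: power2_less_imp_less)
    moreover have "x \<in> U" using x s by auto
    moreover have "F x + of_real \<delta> * g x = F z"
    proof -
      have "g x \<noteq> 0" using \<open>x \<in> U\<close> by (simp add: U_def)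
      then have "F x - F z = - complex_of_real \<delta> * g x"
        using x(2) unfolding \<Phi>_def by (metis nonzero_eq_divide_eq)
      then show ?thesis by (simp add: diff_eq_eq)
    qed
    ultimately show "\<exists>z'\<in>ball z \<eta> \<inter> D. norm z' < norm z \<and> F z' + of_real \<delta> * g z' = F z"
      using x(1) by (intro bexI[of _ x]) (auto simp: s_def U_def)
  qed
qed

lemma inj_on_if_deriv_near_const:
  assumes "convex U" "open U" "F holomorphic_on U" "\<And>x. x \<in> U \<Longrightarrow> norm (deriv F x - c) \<le> norm c / 2" "c \<noteq> 0"
  shows "inj_on F U"
proof (rule inj_onI)
  fix x y assume xy: "x \<in> U" "y \<in> U" "F x = F y"
  have "norm ((F x - c * x) - (F y - c * y)) \<le> norm c / 2 * norm (x - y)"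
  proof (rule field_differentiable_bound[of U "\<lambda>x. F x - c * x" "\<lambda>x. deriv F x - c"])
    show "((\<lambda>x. F x - c * x) has_field_derivative deriv F z - c) (at z within U)" if "z \<in> U" for z
      by (rule derivative_eq_intros has_field_derivative_at_within[OF holomorphic_derivI[OF assms(3,2) that]] refl)+ simp
  qed (use assms xy in auto)
  moreover have "(F x - c * x) - (F y - c * y) = c * (y - x)" using xy(3) by (simp add: algebra_simps)
  ultimately have "norm c * norm (x - y) \<le> norm c / 2 * norm (x - y)"
    by (simp add: norm_mult norm_minus_commute)
  then show "x = y" using assms(5) by (auto simp: mult_le_cancel_right)
qed

lemma continuous_at_pair_eps:
  fixes K :: "real \<times> complex \<Rightarrow> complex"
  assumes "isCont K (s, a)" "e > 0"
  obtains d where "d > 0" "\<And>s' a'. \<bar>s' - s\<bar> < d \<Longrightarrow> dist a a' < d \<Longrightarrow> norm (K (s', a') - K (s, a)) < e"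
proof -
  obtain d where d: "d > 0" "\<And>x. dist x (s, a) < d \<Longrightarrow> dist (K x) (K (s, a)) < e"
    using assms unfolding continuous_at_eps_delta by metis
  show ?thesis
  proof (rule that[of "d/2"])
    fix s' a' assume *: "\<bar>s' - s\<bar> < d / 2" "dist a a' < d / 2"
    have "dist (s', a') (s, a) \<le> dist s' s + dist a' a"
      unfolding dist_Pair_Pair by (rule sqrt_sum_squares_le_sum) auto
    also have "\<dots> < d" using * by (simp add: dist_real_def dist_commute)
    finally show "norm (K (s', a') - K (s, a)) < e" using d(2) by (simp add: dist_norm)
  qed (use d in simp)
qed

text \<open>
  Close-to-convex functions are univalent. The usual proof passes to the convex domain
  \<open>(\<integral> g/z) ` ball 0 1\<close>; here a compactness argument replaces the convexity. Put
  \<open>F s = (1 - s) f + s g\<close>; then \<open>z F s' / g\<close> has positive real part for every \<open>s \<in> [0, 1]\<close>. If \<open>f\<close> is not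
  injective, consider all triples \<open>(s, a, b)\<close> with \<open>a \<noteq> b\<close>, \<open>F s a = F s b\<close> in a fixed closed disc. They
  form a compact set, since the nonvanishing derivatives make the functions \<open>F s\<close> uniformly locally
  injective and so prevent \<open>a\<close> and \<open>b\<close> from merging in the limit. At a triple for which
  \<open>max (norm a) (norm b)\<close> is least, both points can be moved inwards by solving
  \<open>F s z' + \<delta> g z' = F s a\<close>, and \<open>F s + \<delta> g\<close> is a multiple of another member of the family: a
  contradiction.
\<close>
theorem close_to_convex_inj_on:
  fixes f g :: "complex \<Rightarrow> complex"
  assumes holf: "f holomorphic_on ball 0 1" and holg: "g holomorphic_on ball 0 1"
    and zero: "f 0 = 0" "g 0 = 0" and one: "deriv f 0 = 1" "deriv g 0 = 1"
    and gnz: "\<And>z. z \<in> ball 0 1 \<Longrightarrow> z \<noteq> 0 \<Longrightarrow> g z \<noteq> 0"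
    and posf: "\<And>z. z \<in> ball 0 1 \<Longrightarrow> z \<noteq> 0 \<Longrightarrow> Re (z * deriv f z / g z) > 0"
    and posg: "\<And>z. z \<in> ball 0 1 \<Longrightarrow> z \<noteq> 0 \<Longrightarrow> Re (z * deriv g z / g z) > 0"
  shows "inj_on f (ball 0 1)"
proof (rule ccontr)
  define F where "F = (\<lambda>(s::real) z. (1 - of_real s) * f z + of_real s * g z)"
  define dF where "dF = (\<lambda>(s::real) z. (1 - of_real s) * deriv f z + of_real s * deriv g z)"
  have holF: "F s holomorphic_on ball 0 1" for s
    unfolding F_def using holf holg by (intro holomorphic_intros)
  have derF: "(F s has_field_derivative dF s z) (at z)" if "z \<in> ball 0 1" for s z
    unfolding F_def dF_def
    by (rule derivative_eq_intros holomorphic_derivI[OF holf open_ball that]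
        holomorphic_derivI[OF holg open_ball that] refl)+ simp
  then have derivF: "deriv (F s) z = dF s z" if "z \<in> ball 0 1" for s z
    using that by (blast intro: DERIV_imp_deriv)
  have pos: "Re (z * dF s z / g z) > 0" if "z \<in> ball 0 1" "z \<noteq> 0" "s \<in> {0..1}" for s z
  proof -
    have "z * dF s z / g z = of_real (1 - s) * (z * deriv f z / g z) + of_real s * (z * deriv g z / g z)"
      by (simp add: dF_def add_divide_distrib algebra_simps diff_divide_distrib)
    then have eq: "Re (z * dF s z / g z) = (1 - s) * Re (z * deriv f z / g z) + s * Re (z * deriv g z / g z)"
      by (simp only: Re_complex_of_real Im_complex_of_real plus_complex.sel times_complex.sel)
    show ?thesis
    proof (cases "s = 0")
      case True
      then show ?thesis using eq posf that by simp
    next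
      case False
      then have "s * Re (z * deriv g z / g z) > 0" using that posg by (intro mult_pos_pos) auto
      moreover have "(1 - s) * Re (z * deriv f z / g z) \<ge> 0"
        using that posf less_imp_le by (intro mult_nonneg_nonneg) auto
      ultimately show ?thesis using eq by linarith
    qed
  qed
  have dFnz: "dF s z \<noteq> 0" if "z \<in> ball 0 1" "s \<in> {0..1}" for s z
    using pos[of z s] that one by (cases "z = 0") (auto simp: dF_def)
  assume "\<not> inj_on f (ball 0 1)"
  then obtain z1 z2 where z12: "z1 \<in> ball 0 1" "z2 \<in> ball 0 1" "z1 \<noteq> z2" "f z1 = f z2"
    by (auto simp: inj_on_def)
  define R where "R = max (norm z1) (norm z2)"
  have R: "R < 1" using z12 by (simp add: R_def)
  then have cb: "cball 0 R \<subseteq> ball (0::complex) 1" by auto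
  define S where "S = {(s, a, b). s \<in> {0..1} \<and> a \<in> cball 0 R \<and> b \<in> cball 0 R \<and> a \<noteq> b \<and> F s a = F s b}"
  have SK: "S \<subseteq> {0..1} \<times> cball 0 R \<times> cball 0 R" by (auto simp: S_def)
  \<comment> \<open>The only condition that is not obviously closed is \<open>a \<noteq> b\<close>.\<close>
  have "closed S"
    unfolding closed_sequential_limits
  proof (intro allI impI, elim conjE)
    fix x l assume x: "\<forall>n. x n \<in> S" and lim: "x \<longlonglongrightarrow> l"
    obtain s a b where l: "l = (s, a, b)" by (cases l) auto
    define xs xa xb where "xs = (\<lambda>n. fst (x n))" and "xa = (\<lambda>n. fst (snd (x n)))" and "xb = (\<lambda>n. snd (snd (x n)))"
    have lims: "xs \<longlonglongrightarrow> s" "xa \<longlonglongrightarrow> a" "xb \<longlonglongrightarrow> b"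
      using tendsto_fst[OF lim] tendsto_fst[OF tendsto_snd[OF lim]] tendsto_snd[OF tendsto_snd[OF lim]]
      by (simp_all add: l xs_def xa_def xb_def)
    have mem: "xs n \<in> {0..1}" "xa n \<in> cball 0 R" "xb n \<in> cball 0 R" "xa n \<noteq> xb n"
      "F (xs n) (xa n) = F (xs n) (xb n)" for n
      using x[rule_format, of n] by (auto simp: S_def xs_def xa_def xb_def split: prod.splits)
    have s: "s \<in> {0..1}" using closed_sequentially[OF closed_real_atLeastAtMost _ lims(1)] mem by auto
    have a: "a \<in> cball 0 R" using closed_sequentially[OF closed_cball _ lims(2)] mem by blast
    have b: "b \<in> cball 0 R" using closed_sequentially[OF closed_cball _ lims(3)] mem by blast
    have isc: "isCont f z" "isCont g z" if "z \<in> cball 0 R" for z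
      using holf holg that cb by (meson continuous_on_eq_continuous_at holomorphic_on_imp_continuous_on open_ball subsetD)+
    have "(\<lambda>n. F (xs n) (xa n)) \<longlonglongrightarrow> F s a"
      unfolding F_def by (intro tendsto_intros lims isCont_tendsto_compose[OF isc(1)] isCont_tendsto_compose[OF isc(2)] a)
    moreover have "(\<lambda>n. F (xs n) (xb n)) \<longlonglongrightarrow> F s b"
      unfolding F_def by (intro tendsto_intros lims isCont_tendsto_compose[OF isc(1)] isCont_tendsto_compose[OF isc(2)] b)
    ultimately have eq: "F s a = F s b" using mem(5) LIMSEQ_unique by auto
    have "a \<noteq> b"
    proof
      assume ab: "a = b"
      define K where "K = (\<lambda>x::real \<times> complex. dF (fst x) (snd x))"
      have a1: "a \<in> ball 0 1" using a cb by auto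
      have c: "isCont (deriv f) a" "isCont (deriv g) a"
        using holomorphic_deriv[OF holf open_ball] holomorphic_deriv[OF holg open_ball] a1
        by (meson continuous_on_eq_continuous_at holomorphic_on_imp_continuous_on open_ball)+
      have "isCont (\<lambda>x. deriv f (snd x)) (s, a)" "isCont (\<lambda>x. deriv g (snd x)) (s, a)"
        by (rule isCont_o2[OF isCont_snd[OF continuous_ident]], simp add: c)+
      then have "isCont K (s, a)"
        unfolding K_def dF_def by (intro continuous_intros)
      moreover have "norm (dF s a) / 2 > 0" using dFnz[OF a1 s] by simp
      ultimately obtain d where d: "d > 0" "\<And>s' a'. \<bar>s' - s\<bar> < d \<Longrightarrow> dist a a' < d \<Longrightarrow>
          norm (K (s', a') - K (s, a)) < norm (dF s a) / 2"
        using continuous_at_pair_eps by metis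
      obtain d' where d': "d' > 0" "ball a d' \<subseteq> ball 0 1" using a1 by (meson open_ball open_contains_ball)
      define \<epsilon> where "\<epsilon> = min d d'"
      have \<epsilon>: "\<epsilon> > 0" "ball a \<epsilon> \<subseteq> ball 0 1" using d d' by (auto simp: \<epsilon>_def)
      have ev: "\<forall>\<^sub>F n in sequentially. dist (xs n) s < \<epsilon> \<and> dist (xa n) a < \<epsilon> \<and> dist (xb n) a < \<epsilon>"
        using lims[unfolded tendsto_iff, rule_format, OF \<epsilon>(1)] ab by (auto simp: eventually_conj_iff)
      then obtain n where n: "dist (xs n) s < \<epsilon>" "dist (xa n) a < \<epsilon>" "dist (xb n) a < \<epsilon>"
        using eventually_happens'[OF sequentially_bot ev] by blast
      have "inj_on (F (xs n)) (ball a \<epsilon>)"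
      proof (rule inj_on_if_deriv_near_const[where c = "dF s a"])
        show "norm (deriv (F (xs n)) x - dF s a) \<le> norm (dF s a) / 2" if "x \<in> ball a \<epsilon>" for x
        proof -
          have "deriv (F (xs n)) x = K (xs n, x)" using derivF[of x] that \<epsilon> by (auto simp: K_def)
          moreover have "\<bar>xs n - s\<bar> < d" "dist a x < d" using n that by (auto simp: dist_real_def \<epsilon>_def)
          ultimately show ?thesis using d(2)[of "xs n" x] by (simp add: K_def)
        qed
      qed (use holomorphic_on_subset[OF holF \<epsilon>(2)] dFnz[OF a1 s] in auto)
      then have "xa n = xb n"
        by (rule inj_onD) (use mem(5)[of n] n in \<open>auto simp: dist_commute\<close>)
      then show False using mem(4) by blast
    qed
    then show "l \<in> S" using s a b eq by (simp add: S_def l)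
  qed
  then have "compact S"
    using compact_Int_closed[of "{0..1::real} \<times> cball (0::complex) R \<times> cball (0::complex) R" S] SK
    by (simp add: compact_Times inf.absorb2)
  moreover have "(0, z1, z2) \<in> S" using z12 by (auto simp: S_def F_def R_def)
  moreover have "continuous_on S (\<lambda>x. max (norm (fst (snd x))) (norm (snd (snd x))))"
    by (intro continuous_intros)
  ultimately obtain x where x: "x \<in> S" "\<And>y. y \<in> S \<Longrightarrow>
      max (norm (fst (snd x))) (norm (snd (snd x))) \<le> max (norm (fst (snd y))) (norm (snd (snd y)))"
    using continuous_attains_inf[of S] by blast
  obtain s a b where xeq: "x = (s, a, b)" by (cases x) auto
  define m where "m = max (norm a) (norm b)"
  have min: "m \<le> max (norm a') (norm b')" if "(s', a', b') \<in> S" for s' a' b'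
    using x(2)[OF that] by (simp add: m_def xeq)
  have sab: "s \<in> {0..1}" "a \<in> cball 0 R" "b \<in> cball 0 R" "a \<noteq> b" "F s a = F s b"
    using x(1) by (auto simp: S_def xeq)
  have m: "0 < m" "m \<le> R" using sab by (auto simp: m_def less_max_iff_disj)
  define \<eta> where "\<eta> = dist a b / 2"
  have \<eta>: "\<eta> > 0" using sab by (simp add: \<eta>_def)
  have move: "\<exists>e>0. \<forall>\<delta>::real. 0 < \<delta> \<longrightarrow> \<delta> < e \<longrightarrow>
      (\<exists>c'\<in>ball c \<eta>. norm c' < m \<and> F s c' + of_real \<delta> * g c' = F s c)"
    if c: "c \<in> cball 0 R" "norm c \<le> m" for c
  proof (cases "c = 0")
    case True
    then show ?thesis using zero m \<eta> by (intro exI[of _ 1]) (auto intro!: bexI[of _ 0])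
  next
    case False
    have c1: "c \<in> ball 0 1" using c cb by auto
    have "Re (c * deriv (F s) c / g c) > 0" using pos[OF c1 False sab(1)] derivF[OF c1] by simp
    then obtain e where "e > 0" "\<And>\<delta>::real. 0 < \<delta> \<Longrightarrow> \<delta> < e \<Longrightarrow>
       \<exists>z'\<in>ball c \<eta> \<inter> ball 0 1. norm z' < norm c \<and> F s z' + of_real \<delta> * g z' = F s c"
      using solution_moves_inward[OF holF holg open_ball c1 gnz[OF c1 False] _ \<eta>] by metis
    then show ?thesis using c(2) by (intro exI[of _ e]) force
  qed
  obtain ea where ea: "ea > 0" "\<And>\<delta>::real. 0 < \<delta> \<Longrightarrow> \<delta> < ea \<Longrightarrow>
      (\<exists>c'\<in>ball a \<eta>. norm c' < m \<and> F s c' + of_real \<delta> * g c' = F s a)"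
    using move[of a] sab by (auto simp: m_def)
  obtain eb where eb: "eb > 0" "\<And>\<delta>::real. 0 < \<delta> \<Longrightarrow> \<delta> < eb \<Longrightarrow>
      (\<exists>c'\<in>ball b \<eta>. norm c' < m \<and> F s c' + of_real \<delta> * g c' = F s b)"
    using move[of b] sab by (auto simp: m_def)
  define \<delta> where "\<delta> = min ea eb / 2"
  have \<delta>: "0 < \<delta>" "\<delta> < ea" "\<delta> < eb" using ea(1) eb(1) by (auto simp: \<delta>_def)
  obtain a' where a': "a' \<in> ball a \<eta>" "norm a' < m" "F s a' + of_real \<delta> * g a' = F s a"
    using ea(2)[OF \<delta>(1,2)] by auto
  obtain b' where b': "b' \<in> ball b \<eta>" "norm b' < m" "F s b' + of_real \<delta> * g b' = F s b"
    using eb(2)[OF \<delta>(1,3)] by auto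
  have "a' \<noteq> b'"
  proof
    assume "a' = b'"
    then have "dist a b < \<eta> + \<eta>" using a'(1) b'(1) by (intro dist_triangle_less_add[of _ a']) (auto simp: dist_commute)
    then show False by (simp add: \<eta>_def)
  qed
  \<comment> \<open>This is the parameter with \<open>F s + \<delta> g = (1 + \<delta>) F s'\<close>; it leaves \<open>s = 1\<close> fixed.\<close>
  define s' where "s' = (s + \<delta>) / (1 + \<delta>)"
  have s': "s' \<in> {0..1}" using sab(1) \<delta> by (auto simp: s'_def)
  have d1: "1 + complex_of_real \<delta> \<noteq> 0"
    by (metis \<delta>(1) add_pos_pos less_irrefl of_real_1 of_real_add of_real_eq_0_iff zero_less_one)
  have Fs': "F s' c = (F s c + of_real \<delta> * g c) / (1 + of_real \<delta>)" for c
  proof -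
    have "of_real s' * (1 + of_real \<delta>) = of_real s + complex_of_real \<delta>"
      using d1 by (simp add: s'_def)
    then have "F s' c * (1 + of_real \<delta>) = F s c + of_real \<delta> * g c"
      unfolding F_def by algebra
    then show ?thesis using d1 by (simp add: nonzero_eq_divide_eq)
  qed
  have "(s', a', b') \<in> S"
    using s' \<open>a' \<noteq> b'\<close> a' b' m sab(5) by (auto simp: S_def Fs')
  then show False using min a'(2) b'(2) by fastforce
qed

section \<open>Logarithmic primitives and a growth estimate\<close>

lemma log_primitive_exists:
  fixes q :: "complex \<Rightarrow> complex"
  assumes holq: "q holomorphic_on ball 0 1" and q0: "q 0 = 1"
  obtains \<Lambda> where "\<Lambda> holomorphic_on ball 0 1" "\<Lambda> 0 = 0" "\<And>z. z \<in> ball 0 1 \<Longrightarrow> z * deriv \<Lambda> z = q z - 1"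
proof -
  have "(\<lambda>z. q z - 1) holomorphic_on ball 0 1" using holq by (intro holomorphic_intros)
  then obtain k where k: "k holomorphic_on ball 0 1" "\<And>z. norm z < 1 \<Longrightarrow> q z - 1 = z * k z"
    using Schwarz3[of "\<lambda>z. q z - 1" 1] q0 by auto
  obtain K where K: "\<And>z. z \<in> ball 0 1 \<Longrightarrow> (K has_field_derivative k z) (at z within ball 0 1)"
    using holomorphic_convex_primitive'[OF convex_ball open_ball k(1)] by metis
  have K': "((\<lambda>z. K z - K 0) has_field_derivative k z) (at z)" if "z \<in> ball 0 1" for z
    using DERIV_diff[OF K[OF that, unfolded at_within_open[OF that open_ball]] DERIV_const, of "K 0"] by simp
  show ?thesis
  proof (rule that[of "\<lambda>z. K z - K 0"])
    show "(\<lambda>z. K z - K 0) holomorphic_on ball 0 1"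
      unfolding holomorphic_on_open[OF open_ball] using K' by blast
    show "z * deriv (\<lambda>z. K z - K 0) z = q z - 1" if "z \<in> ball 0 1" for z
      using K'[OF that] k(2)[of z] that by (simp add: DERIV_imp_deriv)
  qed simp
qed

lemma deriv_zero_off_0_imp_eq:
  fixes E :: "complex \<Rightarrow> complex"
  assumes "E holomorphic_on ball 0 1" "\<And>z. z \<in> ball 0 1 \<Longrightarrow> z \<noteq> 0 \<Longrightarrow> deriv E z = 0" "z \<in> ball 0 1"
  shows "E z = E 0"
proof -
  obtain c where "\<And>x. x \<in> ball 0 1 \<Longrightarrow> E x = c"
  proof (rule DERIV_zero_connected_constant[of "ball (0::complex) 1" "{0}" E])
    show "\<forall>x\<in>ball 0 1 - {0}. (E has_field_derivative 0) (at x)"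
      using holomorphic_derivI[OF assms(1) open_ball] assms(2) by (metis DiffE insertCI)
  qed (use assms holomorphic_on_imp_continuous_on in auto)
  then show ?thesis using assms(3) by simp
qed

lemma log_primitive_unique:
  fixes q :: "complex \<Rightarrow> complex"
  assumes 1: "\<Lambda> holomorphic_on ball 0 1" "\<Lambda> 0 = 0" "\<And>z. z \<in> ball 0 1 \<Longrightarrow> z * deriv \<Lambda> z = q z - 1"
    and 2: "\<Theta> holomorphic_on ball 0 1" "\<Theta> 0 = 0" "\<And>z. z \<in> ball 0 1 \<Longrightarrow> z * deriv \<Theta> z = q z - 1"
    and z: "z \<in> ball 0 1"
  shows "\<Lambda> z = \<Theta> z"
proof -
  have "(\<lambda>z. \<Lambda> z - \<Theta> z) z = (\<lambda>z. \<Lambda> z - \<Theta> z) 0"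
  proof (rule deriv_zero_off_0_imp_eq[OF _ _ z])
    show "(\<lambda>z. \<Lambda> z - \<Theta> z) holomorphic_on ball 0 1" using 1(1) 2(1) by (intro holomorphic_intros)
    fix x :: complex assume x: "x \<in> ball 0 1" "x \<noteq> 0"
    have "((\<lambda>z. \<Lambda> z - \<Theta> z) has_field_derivative deriv \<Lambda> x - deriv \<Theta> x) (at x)"
      using holomorphic_derivI[OF 1(1) open_ball x(1)] holomorphic_derivI[OF 2(1) open_ball x(1)]
      by (rule DERIV_diff)
    moreover have "x * deriv \<Lambda> x = x * deriv \<Theta> x" using 1(3)[OF x(1)] 2(3)[OF x(1)] by simp
    ultimately show "deriv (\<lambda>z. \<Lambda> z - \<Theta> z) x = 0" using x(2) by (simp add: DERIV_imp_deriv)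
  qed
  then show ?thesis using 1 2 by simp
qed

text \<open>
  The solution of \<open>z g' = g q\<close> normalized at \<open>0\<close>: with \<open>g z = z k z\<close>, the function \<open>k exp (- \<Lambda>)\<close> has
  derivative \<open>0\<close> off the origin.
\<close>
lemma eq_mult_exp_log_primitive:
  fixes g q :: "complex \<Rightarrow> complex"
  assumes g: "g holomorphic_on ball 0 1" "g 0 = 0" "deriv g 0 = 1"
    and gq: "\<And>z. z \<in> ball 0 1 \<Longrightarrow> z * deriv g z = g z * q z"
    and L: "\<Lambda> holomorphic_on ball 0 1" "\<Lambda> 0 = 0" "\<And>z. z \<in> ball 0 1 \<Longrightarrow> z * deriv \<Lambda> z = q z - 1"
    and z: "z \<in> ball 0 1"
  shows "g z = z * exp (\<Lambda> z)"
proof -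
  obtain k where k: "k holomorphic_on ball 0 1" "\<And>z. norm z < 1 \<Longrightarrow> g z = z * k z" "deriv g 0 = k 0"
    using Schwarz3[OF g(1,2)] by metis
  define E where "E = (\<lambda>z. k z * exp (- \<Lambda> z))"
  have "E z = E 0"
  proof (rule deriv_zero_off_0_imp_eq[OF _ _ z])
    show "E holomorphic_on ball 0 1" unfolding E_def using k(1) L(1) by (intro holomorphic_intros)
    fix x :: complex assume x: "x \<in> ball 0 1" "x \<noteq> 0"
    note dk = holomorphic_derivI[OF k(1) open_ball x(1)] and dL = holomorphic_derivI[OF L(1) open_ball x(1)]
    have "((\<lambda>z. z * k z) has_field_derivative k x + x * deriv k x) (at x)"
      by (rule derivative_eq_intros dk refl)+ simp
    then have "(g has_field_derivative k x + x * deriv k x) (at x)"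
      by (rule has_field_derivative_transform_within_open[OF _ open_ball x(1)]) (use k(2) in auto)
    then have "x * (k x + x * deriv k x) = x * k x * q x"
      using gq[OF x(1)] k(2)[of x] x by (simp add: DERIV_imp_deriv)
    then have "k x + x * deriv k x = k x * q x" using x(2) by simp
    then have "x * (deriv k x - k x * deriv \<Lambda> x) = 0"
      using L(3)[OF x(1)] by algebra
    then have 0: "deriv k x - k x * deriv \<Lambda> x = 0" using x(2) by simp
    have "(E has_field_derivative (deriv k x - k x * deriv \<Lambda> x) * exp (- \<Lambda> x)) (at x)"
      unfolding E_def by (rule derivative_eq_intros dk dL refl)+ (simp add: algebra_simps)
    then show "deriv E x = 0" using 0 by (simp add: DERIV_imp_deriv)
  qed
  then have "k z * exp (- \<Lambda> z) = 1" using k(3) g(3) L(2) by (simp add: E_def)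
  then have "k z = exp (\<Lambda> z)" by (simp add: exp_minus field_simps)
  then show ?thesis using k(2) z by simp
qed

text \<open>
  Compare the minimum of \<open>Re L\<close> on a circle of radius \<open>r\<close> with \<open>G (- r)\<close>. Where the minimum is
  attained, the tangential derivative of \<open>Re L\<close> vanishes, so \<open>z L'(z) = \<phi> (\<omega> z) - 1\<close> is real. As \<open>\<phi>\<close>
  is injective and symmetric, \<open>\<omega> z\<close> is then itself real, hence at least \<open>- r\<close>, and the radial derivative
  \<open>\<phi> (\<omega> z) - 1\<close> of \<open>Re L\<close> is at least the radial derivative \<open>\<phi> (- r) - 1\<close> of \<open>G (- r)\<close>. This yields
  the bound on \<open>Re L\<close> that one would otherwise obtain from the convexity of the image of \<open>G\<close> and a
  subordination theorem for its primitives.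
\<close>
lemma Re_log_primitive_subordinate_ge:
  fixes \<phi> \<omega> L G :: "complex \<Rightarrow> complex"
  assumes inj: "inj_on \<phi> (ball 0 1)" and sym: "\<And>z. z \<in> ball 0 1 \<Longrightarrow> \<phi> (cnj z) = cnj (\<phi> z)"
    and mono: "\<And>x y::real. -1 < x \<Longrightarrow> x \<le> y \<Longrightarrow> y < 1 \<Longrightarrow> Re (\<phi> (of_real x)) \<le> Re (\<phi> (of_real y))"
    and \<omega>: "\<And>z. z \<in> ball 0 1 \<Longrightarrow> norm (\<omega> z) \<le> norm z"
    and L: "L holomorphic_on ball 0 1" "L 0 = 0" "\<And>z. z \<in> ball 0 1 \<Longrightarrow> z * deriv L z = \<phi> (\<omega> z) - 1"
    and G: "G holomorphic_on ball 0 1" "G 0 = 0" "\<And>z. z \<in> ball 0 1 \<Longrightarrow> z * deriv G z = \<phi> z - 1"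
    and z: "z \<in> ball 0 1"
  shows "Re (G (- of_real (norm z))) \<le> Re (L z)"
proof (rule field_le_epsilon)
  fix \<epsilon> :: real assume \<epsilon>: "\<epsilon> > 0"
  \<comment> \<open>The term \<open>\<epsilon> * norm x\<close> makes the radial comparison strict.\<close>
  define u where "u = (\<lambda>x. Re (L x) - Re (G (- of_real (norm x))) + \<epsilon> * norm x)"
  have sub: "cball 0 (norm z) \<subseteq> ball (0::complex) 1" using z by auto
  have contL: "continuous_on (cball 0 (norm z)) L"
    using L(1) sub by (meson continuous_on_subset holomorphic_on_imp_continuous_on)
  have contG: "continuous_on (cball 0 (norm z)) (\<lambda>x. G (- of_real (norm x)))"
    by (rule continuous_on_compose2[OF holomorphic_on_imp_continuous_on[OF G(1)]])
       (use sub in \<open>auto intro!: continuous_intros\<close>)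
  have "continuous_on (cball 0 (norm z)) u"
    unfolding u_def by (intro continuous_intros contL contG)
  then obtain z0 where z0: "z0 \<in> cball 0 (norm z)" and min: "\<And>x. x \<in> cball 0 (norm z) \<Longrightarrow> u z0 \<le> u x"
    using continuous_attains_inf[OF compact_cball, of 0 "norm z" u] by auto
  have "u z0 \<ge> 0"
  proof (cases "z0 = 0")
    case True
    then show ?thesis using L G by (simp add: u_def)
  next
    case False
    define r where "r = norm z0"
    have r: "0 < r" "r < 1" "r \<le> norm z" using False z0 z by (auto simp: r_def)
    have z01: "z0 \<in> ball 0 1" using z0 sub by auto
    note dL = holomorphic_derivI[OF L(1) open_ball z01]
    have mr: "- complex_of_real r \<in> ball 0 1" using r by simp
    \<comment> \<open>Tangential direction: \<open>t \<mapsto> z0 exp (i t)\<close>.\<close>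
    have "((\<lambda>t::real. L (z0 * exp (\<i> * of_real t))) has_vector_derivative z0 * \<i> * deriv L z0) (at 0)"
    proof -
      have "((\<lambda>t::real. z0 * exp (\<i> * of_real t)) has_vector_derivative z0 * \<i>) (at 0)"
        by (rule has_vector_derivative_real_field) (auto intro!: derivative_eq_intros)
      from field_vector_diff_chain_at[OF this, of L "deriv L z0"] show ?thesis
        using dL by (simp add: o_def)
    qed
    then have "((\<lambda>t::real. Re (L (z0 * exp (\<i> * of_real t)))) has_real_derivative Re (z0 * \<i> * deriv L z0)) (at 0)"
      by (simp add: has_vector_derivative_complex_iff)
    moreover have "Re (L (z0 * exp (\<i> * of_real 0))) \<le> Re (L (z0 * exp (\<i> * of_real t)))" for t :: real
    proof -
      have "norm (z0 * exp (\<i> * of_real t)) = norm z0" by (simp add: norm_mult)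
      then show ?thesis using min[of "z0 * exp (\<i> * of_real t)"] z0 by (simp add: u_def)
    qed
    ultimately have "Re (z0 * \<i> * deriv L z0) = 0"
      by (intro DERIV_local_min[where x = 0 and d = 1]) auto
    then have "Im (z0 * deriv L z0) = 0" by (simp add: algebra_simps)
    then have "Im (\<phi> (\<omega> z0)) = 0" using L(3)[OF z01] by simp
    then have "\<phi> (cnj (\<omega> z0)) = \<phi> (\<omega> z0)"
      using sym[of "\<omega> z0"] \<omega>[OF z01] z01 by (simp add: complex_eq_iff)
    then have "cnj (\<omega> z0) = \<omega> z0"
      by (rule inj_onD[OF inj]) (use \<omega>[OF z01] z01 in auto)
    then obtain x where x: "\<omega> z0 = of_real x" by (metis Reals_cnj_iff Reals_cases)
    have "\<bar>x\<bar> \<le> r" using \<omega>[OF z01] by (simp add: x r_def)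
    then have ge: "Re (\<phi> (\<omega> z0)) \<ge> Re (\<phi> (of_real (-r)))"
      unfolding x using r by (intro mono) auto
    \<comment> \<open>Radial direction: \<open>t \<mapsto> t z0\<close> at \<open>t = 1\<close>.\<close>
    have dLr: "((\<lambda>t::real. Re (L (of_real t * z0))) has_real_derivative Re (z0 * deriv L z0)) (at 1)"
    proof -
      have "((\<lambda>t::real. of_real t * z0) has_vector_derivative z0) (at 1)"
        by (rule has_vector_derivative_real_field) (auto intro!: derivative_eq_intros)
      from field_vector_diff_chain_at[OF this, of L "deriv L z0"] show ?thesis
        using dL by (simp add: o_def has_vector_derivative_complex_iff)
    qed
    have dGr: "((\<lambda>t::real. Re (G (- of_real (t * r)))) has_real_derivative Re (- of_real r * deriv G (- of_real r))) (at 1)"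
    proof -
      have "((\<lambda>t::real. - of_real t * complex_of_real r) has_vector_derivative - of_real r) (at 1)"
        by (rule has_vector_derivative_real_field) (auto intro!: derivative_eq_intros)
      from field_vector_diff_chain_at[OF this, of G "deriv G (- of_real r)"] show ?thesis
        using holomorphic_derivI[OF G(1) open_ball mr] by (simp add: o_def has_vector_derivative_complex_iff)
    qed
    define D where "D = Re (z0 * deriv L z0) - Re (- of_real r * deriv G (- of_real r)) + \<epsilon> * r"
    have "((\<lambda>t. Re (L (of_real t * z0)) - Re (G (- of_real (t * r))) + \<epsilon> * (t * r)) has_real_derivative D) (at 1)"
      unfolding D_def by (rule derivative_eq_intros dLr dGr refl)+ simp
    moreover have "D > 0"
      using L(3)[OF z01] G(3)[OF mr] ge mult_pos_pos[OF \<epsilon> r(1)] by (simp add: D_def)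
    ultimately obtain d where d: "d > 0" "\<And>h. h > 0 \<Longrightarrow> h < d \<Longrightarrow>
        Re (L (of_real (1 - h) * z0)) - Re (G (- of_real ((1 - h) * r))) + \<epsilon> * ((1 - h) * r)
        < Re (L (of_real 1 * z0)) - Re (G (- of_real (1 * r))) + \<epsilon> * (1 * r)"
      using DERIV_pos_inc_left by blast
    define h where "h = min d 1 / 2"
    have h: "h > 0" "h < d" "h < 1" using d(1) by (auto simp: h_def)
    have nh: "norm (of_real (1 - h) * z0) = (1 - h) * r" using h by (simp add: norm_mult r_def del: of_real_diff)
    moreover have "(1 - h) * r \<le> 1 * norm z" using h r by (intro mult_mono) auto
    ultimately have "u z0 \<le> u (of_real (1 - h) * z0)" by (intro min) simp
    also have "\<dots> < u z0" using d(2)[OF h(1,2)] unfolding u_def nh by (simp add: r_def)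
    finally show ?thesis by simp
  qed
  also have "u z0 \<le> u z" by (rule min) simp
  finally have "Re (G (- of_real (norm z))) \<le> Re (L z) + \<epsilon> * norm z" by (simp add: u_def)
  also have "\<epsilon> * norm z \<le> \<epsilon> * 1" using \<epsilon> z by (intro mult_left_mono) auto
  finally show "Re (G (- of_real (norm z))) \<le> Re (L z) + \<epsilon>" by simp
qed

section \<open>Discs covered by a univalent function\<close>

text \<open>
  Otherwise the inverse would be a bounded entire function. This makes the frontier of the image
  nonempty, so that \<^const>\<open>infdist\<close> measures a genuine distance.
\<close>
lemma inj_disc_image_neq_UNIV:
  assumes "f holomorphic_on ball 0 1" "inj_on f (ball 0 1)"
  shows "f ` ball 0 1 \<noteq> UNIV"
proof
  assume U: "f ` ball 0 1 = UNIV"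
  obtain F where F: "F holomorphic_on f ` ball 0 1" "\<And>z. z \<in> ball 0 1 \<Longrightarrow> F (f z) = z"
    using holomorphic_has_inverse[OF assms(1) open_ball assms(2)] by metis
  have "F w \<in> ball 0 1" for w
  proof -
    have "w \<in> f ` ball 0 1" using U by simp
    then show ?thesis using F(2) by auto
  qed
  then have "range F \<subseteq> ball 0 1" by blast
  then have "F constant_on UNIV"
    using F(1) U by (intro Liouville_theorem) (auto intro: bounded_subset[OF bounded_ball])
  then obtain c where "\<And>w. F w = c" by (auto simp: constant_on_def)
  then have "z = c" if "z \<in> ball 0 1" for z using F(2)[OF that] by simp
  from this[of 0] this[of "1/2"] show False by simp
qed

text \<open>
  Pull the segment from \<open>0\<close> to \<open>v\<close> back by the inverse of \<open>f\<close>. The speed of the preimage curve at a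
  point of modulus \<open>r\<close> is at most \<open>norm v / M' r\<close>, so \<open>M\<close> of its modulus grows at rate at most
  \<open>norm v\<close>.
\<close>
lemma norm_inverse_branch_along_ray:
  fixes f :: "complex \<Rightarrow> complex" and M M' :: "real \<Rightarrow> real"
  assumes holf: "f holomorphic_on ball 0 1" and inj: "inj_on f (ball 0 1)" and f0: "f 0 = 0"
    and M: "continuous_on {0..<1} M" "M 0 = 0"
      "\<And>r. 0 < r \<Longrightarrow> r < 1 \<Longrightarrow> (M has_real_derivative M' r) (at r)" "\<And>r. 0 < r \<Longrightarrow> r < 1 \<Longrightarrow> M' r > 0"
    and lower: "\<And>z. z \<in> ball 0 1 \<Longrightarrow> z \<noteq> 0 \<Longrightarrow> norm (deriv f z) \<ge> M' (norm z)"
    and ray: "\<And>t. 0 \<le> t \<Longrightarrow> t \<le> 1 \<Longrightarrow> of_real t * v \<in> f ` ball 0 1"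
    and x: "x \<in> ball 0 1" "f x = v"
  shows "M (norm x) \<le> norm v"
proof -
  obtain F where F: "F holomorphic_on f ` ball 0 1" "\<And>z. z \<in> ball 0 1 \<Longrightarrow> deriv f z * deriv F (f z) = 1"
      "\<And>z. z \<in> ball 0 1 \<Longrightarrow> F (f z) = z"
    using holomorphic_has_inverse[OF holf open_ball inj] by metis
  have op: "open (f ` ball 0 1)" using open_mapping_thm3[OF holf open_ball inj] .
  define \<gamma> where "\<gamma> = (\<lambda>t::real. F (of_real t * v))"
  have \<gamma>: "\<gamma> t \<in> ball 0 1" "f (\<gamma> t) = of_real t * v" if "0 \<le> t" "t \<le> 1" for t
    using ray[OF that] F(3) by (auto simp: \<gamma>_def)
  have d\<gamma>: "(\<gamma> has_vector_derivative v * deriv F (of_real t * v)) (at t)" if "0 \<le> t" "t \<le> 1" for t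
  proof -
    have "((\<lambda>t::real. of_real t * v) has_vector_derivative v) (at t)"
      by (rule has_vector_derivative_real_field) (auto intro!: derivative_eq_intros)
    from field_vector_diff_chain_at[OF this holomorphic_derivI[OF F(1) op ray[OF that]]]
    show ?thesis by (simp add: o_def \<gamma>_def)
  qed
  have cont\<gamma>: "continuous_on {0..1} \<gamma>"
    using d\<gamma> by (auto intro!: continuous_at_imp_continuous_on has_vector_derivative_continuous)
  have "v = 0 \<or> v \<noteq> 0" by simp
  then show ?thesis
  proof
    assume "v = 0"
    then have "x = 0" using inj_onD[OF inj, of x 0] x f0 by simp
    then show ?thesis using M by simp
  next
    assume v: "v \<noteq> 0"
    define u where "u = (\<lambda>t. M (norm (\<gamma> t)) - t * norm v)"
    have "u 1 \<le> u 0"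
    proof (rule DERIV_nonpos_imp_decreasing_open[where f = u and a = 0 and b = 1])
      show "continuous_on {0..1} u"
        unfolding u_def by (intro continuous_intros continuous_on_compose2[OF M(1)] cont\<gamma>) (use \<gamma> in auto)
      fix t :: real assume t: "0 < t" "t < 1"
      define y where "y = \<gamma> t"
      define c where "c = v * deriv F (of_real t * v)"
      have y: "y \<in> ball 0 1" "f y = of_real t * v" using \<gamma>[of t] t by (auto simp: y_def)
      have y0: "y \<noteq> 0" using y(2) f0 v t by auto
      have ny: "0 < norm y" "norm y < 1" using y y0 by auto
      have "(norm has_derivative (\<lambda>h. y \<bullet> h / norm y)) (at (\<gamma> t))"
        using has_derivative_norm[OF y0]
        by (simp add: y_def sgn_div_norm inner_commute divide_inverse mult.commute)
      from diff_chain_at[OF d\<gamma>[unfolded has_vector_derivative_def, of t] this] t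
      have "(norm \<circ> \<gamma> has_derivative (\<lambda>h. y \<bullet> h / norm y) \<circ> (\<lambda>x. x *\<^sub>R c)) (at t)"
        by (simp add: c_def)
      then have "((\<lambda>t. norm (\<gamma> t)) has_real_derivative (y \<bullet> c / norm y)) (at t)"
        unfolding has_field_derivative_def o_def by (rule has_derivative_eq_rhs) (simp add: fun_eq_iff)
      from DERIV_chain2[OF M(3)[OF ny, unfolded y_def] this]
      have "(u has_real_derivative M' (norm y) * (y \<bullet> c / norm y) - norm v) (at t)"
        unfolding u_def y_def[symmetric] by (auto intro!: derivative_eq_intros)
      moreover have "M' (norm y) * (y \<bullet> c / norm y) - norm v \<le> 0"
      proof -
        have "y \<bullet> c \<le> norm y * norm c" by (rule norm_cauchy_schwarz)
        then have "y \<bullet> c / norm y \<le> norm c" using ny by (simp add: divide_le_eq mult.commute)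
        then have "M' (norm y) * (y \<bullet> c / norm y) \<le> M' (norm y) * norm c"
          using M(4)[OF ny] by (intro mult_left_mono) auto
        also have "\<dots> \<le> norm (deriv f y) * norm c" using lower[OF y(1) y0] by (intro mult_right_mono) auto
        also have "\<dots> = norm (v * (deriv f y * deriv F (f y)))" by (simp add: c_def y(2) norm_mult)
        also have "\<dots> = norm v" using F(2)[OF y(1)] by simp
        finally show ?thesis by simp
      qed
      ultimately show "\<exists>y. (u has_real_derivative y) (at t) \<and> y \<le> 0" by blast
    qed simp
    moreover have "\<gamma> 1 = x" "\<gamma> 0 = 0" using F(3)[OF x(1)] F(3)[of 0] x(2) f0 by (auto simp: \<gamma>_def)
    ultimately show ?thesis using M(2) by (simp add: u_def)
  qed
qed

text \<open>
  Let \<open>d\<close> be the distance from \<open>0\<close> to the frontier. If \<open>d < M \<rho>\<close>, the preimages of the points of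
  \<open>ball 0 d\<close> stay in \<open>cball 0 \<rho>\<close>. So the nearest frontier point lies in the compact set
  \<open>f ` cball 0 \<rho>\<close>, hence in the open image, which is impossible.
\<close>
theorem boundary_dist_ge_of_deriv_ge:
  fixes f :: "complex \<Rightarrow> complex" and M M' :: "real \<Rightarrow> real"
  assumes holf: "f holomorphic_on ball 0 1" and inj: "inj_on f (ball 0 1)" and f0: "f 0 = 0"
    and M: "continuous_on {0..<1} M" "M 0 = 0"
      "\<And>r. 0 < r \<Longrightarrow> r < 1 \<Longrightarrow> (M has_real_derivative M' r) (at r)" "\<And>r. 0 < r \<Longrightarrow> r < 1 \<Longrightarrow> M' r > 0"
    and lower: "\<And>z. z \<in> ball 0 1 \<Longrightarrow> z \<noteq> 0 \<Longrightarrow> norm (deriv f z) \<ge> M' (norm z)"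
    and \<rho>: "0 < \<rho>" "\<rho> < 1"
  shows "M \<rho> \<le> boundary_dist f"
proof (rule ccontr)
  assume neg: "\<not> M \<rho> \<le> boundary_dist f"
  define V where "V = f ` ball 0 1"
  have op: "open V" unfolding V_def using open_mapping_thm3[OF holf open_ball inj] .
  have zV: "0 \<in> V" using f0 unfolding V_def by (metis centre_in_ball imageI zero_less_one)
  have ne: "frontier V \<noteq> {}"
    using inj_disc_image_neq_UNIV[OF holf inj] zV by (auto simp: frontier_eq_empty V_def)
  define d where "d = infdist 0 (frontier V)"
  obtain w where w: "w \<in> frontier V" "infdist 0 (frontier V) = dist 0 w"
    using infdist_attains_inf[OF frontier_closed ne] by blast
  have disj: "V \<inter> frontier V = {}" using op by (simp add: frontier_def interior_open Diff_Int_distrib) 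
  have d: "d = norm w" "d < M \<rho>" using w neg f0 by (auto simp: d_def boundary_dist_def V_def)
  have "d > 0" using disj zV w(1) d(1) by (metis IntI empty_iff norm_eq_zero norm_ge_zero order_le_less)
  have sub: "ball 0 d \<subseteq> V"
  proof (rule ccontr)
    assume "\<not> ball 0 d \<subseteq> V"
    moreover have "0 \<in> ball 0 d \<inter> V" using zV \<open>d > 0\<close> by simp
    ultimately have "ball 0 d \<inter> frontier V \<noteq> {}"
      by (intro connected_Int_frontier) blast+
    then obtain x where "x \<in> frontier V" "norm x < d" by auto
    then show False using infdist_le[of x "frontier V" 0] by (simp add: d_def)
  qed
  have "ball (0::complex) d \<subseteq> f ` cball 0 \<rho>"
  proof
    fix v :: complex assume v: "v \<in> ball 0 d"
    then obtain x where x: "x \<in> ball 0 1" "f x = v" using sub by (auto simp: V_def)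
    have "M (norm x) \<le> norm v"
    proof (rule norm_inverse_branch_along_ray[OF holf inj f0 M lower _ x])
      fix t :: real assume t: "0 \<le> t" "t \<le> 1"
      have "norm (of_real t * v) \<le> norm v" using t by (simp add: norm_mult mult_left_le_one_le)
      then show "of_real t * v \<in> f ` ball 0 1" using v sub by (auto simp: V_def subset_iff)
    qed
    have "norm x \<le> \<rho>"
    proof (rule ccontr)
      assume "\<not> norm x \<le> \<rho>"
      moreover have "norm x < 1" using x(1) by simp
      ultimately have lt: "\<rho> < norm x" "norm x < 1" by auto
      have "M \<rho> < M (norm x)"
      proof (rule DERIV_pos_imp_increasing[where f = M, OF lt(1)])
        fix s assume "\<rho> \<le> s" "s \<le> norm x"
        then have "0 < s" "s < 1" using \<rho> lt by auto
        then show "\<exists>y. (M has_real_derivative y) (at s) \<and> 0 < y" using M(3,4) by blast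
      qed
      then show False using \<open>M (norm x) \<le> norm v\<close> v d by simp
    qed
    then show "v \<in> f ` cball 0 \<rho>" using x by auto
  qed
  moreover have sub1: "cball (0::complex) \<rho> \<subseteq> ball 0 1" using \<rho> by auto
  have "compact (f ` cball 0 \<rho>)"
    by (intro compact_continuous_image continuous_on_subset[OF holomorphic_on_imp_continuous_on[OF holf] sub1]) simp
  ultimately have "closure (ball 0 d) \<subseteq> f ` cball 0 \<rho>"
    by (intro closure_minimal compact_imp_closed)
  then have "cball 0 d \<subseteq> f ` ball 0 1" using \<open>d > 0\<close> image_mono[OF sub1, of f] by simp
  moreover have "w \<in> cball 0 d" using d(1) by simp
  ultimately have "w \<in> V" unfolding V_def by blast
  then show False using w(1) disj by auto
qed

section \<open>Coefficient bounds and majorant series\<close>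

text \<open>
  For \<open>n \<ge> 1\<close> the conjugate of \<open>u\<close> is orthogonal to \<open>cis (n t)\<close> on circles around \<open>0\<close>, so \<open>u\<close> may be
  replaced by \<open>2 Re u \<ge> 0\<close> in the integral for its \<open>n\<close>-th coefficient, and the mean of \<open>Re u\<close> is \<open>Re (u 0)\<close>.
\<close>
lemma Caratheodory_coeff_bound:
  fixes u :: "complex \<Rightarrow> complex"
  assumes hol: "u holomorphic_on ball 0 1" and pos: "\<And>z. z \<in> ball 0 1 \<Longrightarrow> Re (u z) \<ge> 0" and n: "n \<ge> 1"
  shows "norm (fps_nth (fps_expansion u 0) n) \<le> 2 * Re (u 0)"
proof -
  define c where "c = fps_nth (fps_expansion u 0) n"
  have bound: "\<rho> ^ n * norm c \<le> 2 * Re (u 0)" if \<rho>: "0 < \<rho>" "\<rho> < 1" for \<rho>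
  proof -
    have sub: "cball 0 \<rho> \<subseteq> ball (0::complex) 1" using \<rho> by auto
    have cont: "continuous_on (cball 0 \<rho>) u"
      using continuous_on_subset[OF holomorphic_on_imp_continuous_on[OF hol] sub] .
    have hol': "u holomorphic_on ball 0 \<rho>" using hol \<rho> by (auto intro: holomorphic_on_subset)
    have cauchy: "((\<lambda>t. u (of_real \<rho> * cis t) * cis (- (real k * t))) has_integral
        2 * pi * of_real (\<rho> ^ k) * fps_nth (fps_expansion u 0) k) {0..2*pi}" for k
    proof -
      have "((\<lambda>w. u w / (w - 0) ^ Suc k) has_contour_integral
          2 * pi * \<i> / fact k * (deriv ^^ k) u 0) (circlepath 0 \<rho>)"
        by (rule Cauchy_has_contour_integral_higher_derivative_circlepath[OF cont hol']) (use \<rho> in simp)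
      then have "((\<lambda>t. u (of_real \<rho> * cis t) / (of_real \<rho> * cis t) ^ Suc k * of_real \<rho> * \<i> * cis t) has_integral
          2 * pi * \<i> / fact k * (deriv ^^ k) u 0) {0..2*pi}"
        unfolding circlepath_def by (subst (asm) has_contour_integral_part_circlepath_iff) auto
      from has_integral_mult_right[OF this, of "of_real (\<rho> ^ k) / \<i>"]
      have "((\<lambda>t. of_real (\<rho> ^ k) / \<i> * (u (of_real \<rho> * cis t) / (of_real \<rho> * cis t) ^ Suc k * of_real \<rho> * \<i> * cis t))
          has_integral 2 * pi * of_real (\<rho> ^ k) * fps_nth (fps_expansion u 0) k) {0..2*pi}"
        by (simp add: fps_expansion_def field_simps)
      moreover have "of_real (\<rho> ^ k) / \<i> * (u (of_real \<rho> * cis t) / (of_real \<rho> * cis t) ^ Suc k * of_real \<rho> * \<i> * cis t)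
          = u (of_real \<rho> * cis t) * cis (- (real k * t))" for t
      proof -
        have "cis (- (real k * t)) = inverse (cis t ^ k)" unfolding Complex.DeMoivre cis_inverse by simp
        moreover have "R ^ k / \<i> * (U / (R * w) ^ Suc k * R * \<i> * w) = U * inverse (w ^ k)"
          if "R \<noteq> 0" "w \<noteq> 0" for R w U :: complex
          using that by (simp add: power_mult_distrib field_simps)
        ultimately show ?thesis using \<rho> by simp
      qed
      ultimately show ?thesis by simp
    qed
    have vanish: "((\<lambda>t. u (of_real \<rho> * cis t) * cis (real n * t)) has_integral 0) {0..2*pi}"
    proof -
      obtain m where m: "n = Suc m" using n by (cases n) auto
      have "((\<lambda>w. u w * w ^ m) has_contour_integral 0) (circlepath 0 \<rho>)"
        by (rule Cauchy_theorem_disc_simple[where a = 0 and e = 1])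
           (use \<rho> sub in \<open>auto intro!: holomorphic_intros hol\<close>)
      then have "((\<lambda>t. u (of_real \<rho> * cis t) * (of_real \<rho> * cis t) ^ m * of_real \<rho> * \<i> * cis t) has_integral 0) {0..2*pi}"
        unfolding circlepath_def by (subst (asm) has_contour_integral_part_circlepath_iff) auto
      from has_integral_mult_right[OF this, of "1 / (\<i> * of_real (\<rho> ^ n))"]
      have "((\<lambda>t. 1 / (\<i> * of_real (\<rho> ^ n)) * (u (of_real \<rho> * cis t) * (of_real \<rho> * cis t) ^ m * of_real \<rho> * \<i> * cis t)) has_integral 0) {0..2*pi}"
        by simp
      moreover have "1 / (\<i> * of_real (\<rho> ^ n)) * (u (of_real \<rho> * cis t) * (of_real \<rho> * cis t) ^ m * of_real \<rho> * \<i> * cis t)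
          = u (of_real \<rho> * cis t) * cis (real n * t)" for t
      proof -
        have "cis (real n * t) = cis t ^ m * cis t" by (simp add: Complex.DeMoivre m cis_mult algebra_simps)
        moreover have "1 / (\<i> * R ^ Suc m) * (U * (R * w) ^ m * R * \<i> * w) = U * (w ^ m * w)"
          if "R \<noteq> 0" for R w U :: complex
          using that by (simp add: power_mult_distrib field_simps)
        ultimately show ?thesis using \<rho> by (simp add: m)
      qed
      ultimately show ?thesis by simp
    qed
    have vanish': "((\<lambda>t. cnj (u (of_real \<rho> * cis t)) * cis (- (real n * t))) has_integral 0) {0..2*pi}"
      using vanish has_integral_cnj[of "\<lambda>t. u (of_real \<rho> * cis t) * cis (real n * t)" 0 "{0..2*pi}"]
      by (simp add: o_def cis_cnj)
    have int1: "((\<lambda>t. of_real (2 * Re (u (of_real \<rho> * cis t))) * cis (- (real n * t))) has_integral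
        2 * pi * of_real (\<rho> ^ n) * c) {0..2*pi}"
    proof -
      have "of_real (2 * Re w) * v = w * v + cnj w * v" for w v :: complex
        using complex_add_cnj[of w] by (metis distrib_right)
      then show ?thesis using has_integral_add[OF cauchy[of n] vanish'] by (simp add: c_def)
    qed
    have int2: "((\<lambda>t. 2 * Re (u (of_real \<rho> * cis t))) has_integral 2 * (2 * pi * Re (u 0))) {0..2*pi}"
    proof -
      have "((\<lambda>t. Re (u (of_real \<rho> * cis t))) has_integral 2 * pi * Re (u 0)) {0..2*pi}"
        using has_integral_Re[OF cauchy[of 0]] by (simp add: fps_expansion_def)
      then show ?thesis by (rule has_integral_mult_right)
    qed
    have "norm (2 * pi * of_real (\<rho> ^ n) * c) \<le> 2 * (2 * pi * Re (u 0))"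
    proof -
      have "norm (2 * pi * of_real (\<rho> ^ n) * c) \<le> (2 * (2 * pi * Re (u 0))) \<bullet> 1"
      proof (rule has_integral_norm_bound_integral_component[OF int1 int2])
        fix t assume "t \<in> {0..2*pi}"
        have "Re (u (of_real \<rho> * cis t)) \<ge> 0" by (rule pos) (use \<rho> in \<open>simp add: norm_mult\<close>)
        then show "norm (of_real (2 * Re (u (of_real \<rho> * cis t))) * cis (- (real n * t)))
            \<le> (2 * Re (u (of_real \<rho> * cis t))) \<bullet> 1" by (simp add: norm_mult)
      qed
      then show ?thesis by simp
    qed
    moreover have "norm (2 * pi * of_real (\<rho> ^ n) * c) = 2 * pi * (\<rho> ^ n * norm c)"
      using \<rho> by (simp add: norm_mult norm_power)
    ultimately have "2 * pi * (\<rho> ^ n * norm c) \<le> 2 * pi * (2 * Re (u 0))" by simp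
    then show ?thesis by (subst (asm) mult_le_cancel_left_pos) auto
  qed
  have "((\<lambda>\<rho>::real. \<rho> ^ n * norm c) \<longlongrightarrow> 1 ^ n * norm c) (at_left 1)" by (intro tendsto_intros)
  moreover have "\<forall>\<^sub>F \<rho> in at_left (1::real). \<rho> ^ n * norm c \<le> 2 * Re (u 0)"
    using eventually_at_left_real[of 0 "1::real"] by (auto elim!: eventually_mono intro: bound)
  ultimately have "1 ^ n * norm c \<le> 2 * Re (u 0)"
    by (intro tendsto_upperbound) auto
  then show ?thesis by (simp add: c_def)
qed

lemma bounded_coeff_bound:
  fixes \<psi> :: "complex \<Rightarrow> complex"
  assumes hol: "\<psi> holomorphic_on ball 0 1" and le1: "\<And>z. z \<in> ball 0 1 \<Longrightarrow> norm (\<psi> z) \<le> 1" and n: "n \<ge> 1"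
  shows "norm (fps_nth (fps_expansion \<psi> 0) n) \<le> 2 * (1 - norm (\<psi> 0))"
proof -
  \<comment> \<open>A rotation that makes the value at \<open>0\<close> a nonnegative real number.\<close>
  define a where "a = (if \<psi> 0 = 0 then 1 else cnj (\<psi> 0) / norm (\<psi> 0))"
  have a: "norm a = 1" "a * \<psi> 0 = norm (\<psi> 0)"
    by (auto simp: a_def norm_divide complex_norm_square power2_eq_square)
       (metis complex_norm_square mult.commute nonzero_mult_div_cancel_left norm_eq_zero of_real_eq_0_iff of_real_mult power2_eq_square)
  define u where "u = (\<lambda>z. 1 - a * \<psi> z)"
  have "\<psi> has_fps_expansion fps_expansion \<psi> 0"
    by (rule has_fps_expansion_fps_expansion[OF open_ball _ hol]) simp
  then have "u has_fps_expansion 1 - fps_const a * fps_expansion \<psi> 0"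
    unfolding u_def by (intro fps_expansion_intros)
  then have "fps_expansion u 0 = 1 - fps_const a * fps_expansion \<psi> 0" by (rule fps_expansion_eqI)
  then have "norm (fps_nth (fps_expansion u 0) n) = norm (fps_nth (fps_expansion \<psi> 0) n)"
    using n a(1) by (simp add: norm_mult)
  moreover have "norm (fps_nth (fps_expansion u 0) n) \<le> 2 * Re (u 0)"
  proof (rule Caratheodory_coeff_bound[OF _ _ n])
    show "u holomorphic_on ball 0 1" unfolding u_def using hol by (intro holomorphic_intros)
    fix z :: complex assume "z \<in> ball 0 1"
    then have "norm (a * \<psi> z) \<le> 1" using le1 a(1) by (simp add: norm_mult)
    then show "Re (u z) \<ge> 0" using complex_Re_le_cmod[of "a * \<psi> z"] unfolding u_def by simp
  qed
  moreover have "Re (u 0) = 1 - norm (\<psi> 0)" by (simp add: u_def a(2) del: times_complex.sel)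
  ultimately show ?thesis by simp
qed

text \<open>
  A partial sum of the majorant series. Working with partial sums keeps every inequality below
  finite; convergence comes out at the end from a uniform bound.
\<close>
definition majorant :: "nat \<Rightarrow> real \<Rightarrow> complex fps \<Rightarrow> real" where
  "majorant N r A = (\<Sum>n\<le>N. norm (fps_nth A n) * r ^ n)"

lemma majorant_nonneg: "r \<ge> 0 \<Longrightarrow> majorant N r A \<ge> 0"
  by (simp add: majorant_def sum_nonneg)

lemma convolution_partial_sum_le:
  fixes a b :: "nat \<Rightarrow> real"
  assumes "\<And>n. a n \<ge> 0" "\<And>n. b n \<ge> 0" "r \<ge> 0"
  shows "(\<Sum>n\<le>N. (\<Sum>i\<le>n. a i * b (n - i)) * r ^ n) \<le> (\<Sum>n\<le>N. a n * r ^ n) * (\<Sum>n\<le>N. b n * r ^ n)"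
proof -
  have split: "(a i * b (n - i)) * r ^ n = (a i * r ^ i) * (b (n - i) * r ^ (n - i))" if "i \<in> {..n}" for i n
  proof -
    have "r ^ n = r ^ i * r ^ (n - i)" using that by (simp add: power_add[symmetric])
    then show ?thesis by (simp add: mult_ac)
  qed
  have "(\<Sum>n\<le>N. (\<Sum>i\<le>n. a i * b (n - i)) * r ^ n) = (\<Sum>n\<le>N. \<Sum>i\<le>n. (a i * r ^ i) * (b (n - i) * r ^ (n - i)))"
    unfolding sum_distrib_right by (intro sum.cong refl split)
  also have "\<dots> = (\<Sum>(i,j)\<in>{(i,j). i + j \<le> N}. (a i * r ^ i) * (b j * r ^ j))"
    by (rule sum.triangle_reindex_eq[symmetric])
  also have "\<dots> \<le> (\<Sum>(i,j)\<in>{..N}\<times>{..N}. (a i * r ^ i) * (b j * r ^ j))"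
    by (rule sum_mono2) (use assms in auto)
  also have "\<dots> = (\<Sum>n\<le>N. a n * r ^ n) * (\<Sum>n\<le>N. b n * r ^ n)"
    by (simp add: sum_product sum.cartesian_product)
  finally show ?thesis .
qed

lemma majorant_mult_le:
  assumes "r \<ge> 0"
  shows "majorant N r (A * B) \<le> majorant N r A * majorant N r B"
proof -
  have "majorant N r (A * B) \<le> (\<Sum>n\<le>N. (\<Sum>i\<le>n. norm (fps_nth A i) * norm (fps_nth B (n - i))) * r ^ n)"
    unfolding majorant_def fps_mult_nth atLeast0AtMost
    by (intro sum_mono mult_right_mono order.trans[OF norm_sum] sum_mono) (use assms in \<open>auto simp: norm_mult\<close>)
  also have "\<dots> \<le> majorant N r A * majorant N r B"
    unfolding majorant_def by (rule convolution_partial_sum_le) (use assms in auto)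
  finally show ?thesis .
qed

lemma majorant_power_le:
  assumes "r \<ge> 0"
  shows "majorant N r (A ^ k) \<le> majorant N r A ^ k"
proof (induction k)
  case 0
  have "majorant N r 1 = (\<Sum>n\<le>N. if n = 0 then 1 else 0)"
    unfolding majorant_def by (intro sum.cong) auto
  then show ?case by (simp add: sum.delta)
next
  case (Suc k)
  have "majorant N r (A * A ^ k) \<le> majorant N r A * majorant N r (A ^ k)" by (rule majorant_mult_le[OF assms])
  also have "\<dots> \<le> majorant N r A * majorant N r A ^ k"
    by (intro mult_left_mono Suc majorant_nonneg assms)
  finally show ?case by simp
qed

text \<open>
  The \<open>n\<close>-th coefficient of \<open>A oo B\<close> involves only the powers \<open>B ^ i\<close> with \<open>i \<le> n\<close>, and the majorant of
  \<open>B ^ i\<close> is at most \<open>r ^ i\<close>.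
\<close>
lemma majorant_compose_le:
  assumes "r \<ge> 0" "majorant N r B \<le> r"
  shows "majorant N r (A oo B) \<le> majorant N r A"
proof -
  have "norm (fps_nth (A oo B) n) \<le> (\<Sum>i\<le>N. norm (fps_nth A i) * norm (fps_nth (B ^ i) n))" if "n \<le> N" for n
  proof -
    have "norm (fps_nth (A oo B) n) \<le> (\<Sum>i\<le>n. norm (fps_nth A i) * norm (fps_nth (B ^ i) n))"
      unfolding fps_compose_nth atLeast0AtMost by (intro order.trans[OF norm_sum] sum_mono) (simp add: norm_mult)
    also have "\<dots> \<le> (\<Sum>i\<le>N. norm (fps_nth A i) * norm (fps_nth (B ^ i) n))"
      using that by (intro sum_mono2) auto
    finally show ?thesis .
  qed
  then have "majorant N r (A oo B) \<le> (\<Sum>n\<le>N. (\<Sum>i\<le>N. norm (fps_nth A i) * norm (fps_nth (B ^ i) n)) * r ^ n)"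
    unfolding majorant_def by (intro sum_mono mult_right_mono) (use assms in auto)
  also have "\<dots> = (\<Sum>i\<le>N. norm (fps_nth A i) * majorant N r (B ^ i))"
    unfolding majorant_def sum_distrib_left sum_distrib_right by (subst sum.swap) (simp add: mult_ac)
  also have "\<dots> \<le> (\<Sum>i\<le>N. norm (fps_nth A i) * r ^ i)"
    using assms by (intro sum_mono mult_left_mono order.trans[OF majorant_power_le] power_mono majorant_nonneg) auto
  finally show ?thesis by (simp add: majorant_def)
qed

lemma third_geometric_le: "(\<Sum>n<N. (1/3::real) ^ Suc n) \<le> 1 / 2"
proof -
  have "(\<Sum>n<N. (1/3::real) ^ Suc n) = (1 - (1/3) ^ N) / 2"
  proof (induction N)
    case (Suc N)
    have "(1 - q) / 2 + 1 / 3 * q = (1 - 1 / 3 * q) / 2" for q :: real by (simp add: field_simps)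
    then show ?case using Suc by (simp only: sum.lessThan_Suc power_Suc)
  qed simp
  then show ?thesis by simp
qed

text \<open>
  Bohr's theorem for \<open>\<psi> z = \<omega> z / z\<close>: its coefficients are at most \<open>2 (1 - norm (\<psi> 0))\<close>, and the
  geometric series of ratio \<open>1/3\<close> without its first term sums to \<open>1/2\<close>. This is the origin of the
  constant \<open>1/3\<close>.
\<close>
lemma majorant_Schwarz_function_le:
  fixes \<omega> :: "complex \<Rightarrow> complex"
  assumes hol: "\<omega> holomorphic_on ball 0 1" and \<omega>0: "\<omega> 0 = 0" and lt1: "\<And>z. norm z < 1 \<Longrightarrow> norm (\<omega> z) < 1"
    and r: "0 \<le> r" "r \<le> 1/3"
  shows "majorant N r (fps_expansion \<omega> 0) \<le> r"
proof -
  obtain \<psi> where \<psi>: "\<psi> holomorphic_on ball 0 1" "\<And>z. norm z < 1 \<Longrightarrow> \<omega> z = z * \<psi> z" "deriv \<omega> 0 = \<psi> 0"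
    using Schwarz3[OF hol \<omega>0] by metis
  have \<psi>1: "norm (\<psi> z) \<le> 1" if "z \<in> ball 0 1" for z
  proof (cases "z = 0")
    case True
    then show ?thesis using Schwarz_Lemma(2)[OF hol \<omega>0 lt1 , of 0] \<psi>(3) by simp
  next
    case False
    then show ?thesis using Schwarz_Lemma(1)[OF hol \<omega>0 lt1, of z] \<psi>(2)[of z] that by (simp add: norm_mult)
  qed
  define C where "C = fps_expansion \<psi> 0"
  have \<psi>C: "\<psi> has_fps_expansion C"
    unfolding C_def by (rule has_fps_expansion_fps_expansion[OF open_ball _ \<psi>(1)]) simp
  have "eventually (\<lambda>z. z \<in> ball 0 1) (nhds (0::complex))" by (rule eventually_nhds_in_open) auto
  then have ev: "eventually (\<lambda>z. \<omega> z = z * \<psi> z) (nhds 0)" by eventually_elim (use \<psi>(2) in auto)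
  have "(\<lambda>z. z * \<psi> z) has_fps_expansion fps_X * C" by (intro fps_expansion_intros \<psi>C)
  then have W: "fps_expansion \<omega> 0 = fps_X * C"
    using fps_expansion_cong[OF ev] fps_expansion_eqI by metis
  have C0: "fps_nth C 0 = \<psi> 0" by (simp add: C_def fps_expansion_def)
  have "majorant N r (fps_X * C) \<le> majorant (Suc N) r (fps_X * C)"
    unfolding majorant_def by (rule sum_mono2) (use r in auto)
  also have "\<dots> = r * (\<Sum>n\<le>N. norm (fps_nth C n) * r ^ n)"
    unfolding majorant_def by (subst sum.atMost_Suc_shift) (simp add: sum_distrib_left mult_ac)
  also have "\<dots> \<le> r * 1"
  proof (rule mult_left_mono)
    have split: "(\<Sum>n\<le>N. norm (fps_nth C n) * r ^ n) = norm (\<psi> 0) + (\<Sum>n<N. norm (fps_nth C (Suc n)) * r ^ Suc n)"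
      unfolding lessThan_Suc_atMost[symmetric] by (subst sum.lessThan_Suc_shift) (simp add: C0)
    have "(\<Sum>n<N. norm (fps_nth C (Suc n)) * r ^ Suc n) \<le> (\<Sum>n<N. 2 * (1 - norm (\<psi> 0)) * (1/3) ^ Suc n)"
      unfolding C_def by (intro sum_mono mult_mono bounded_coeff_bound power_mono \<psi> \<psi>1) (use r \<psi>1[of 0] in auto)
    also have "\<dots> = 2 * (1 - norm (\<psi> 0)) * (\<Sum>n<N. (1/3) ^ Suc n)" by (simp add: sum_distrib_left)
    also have "\<dots> \<le> 2 * (1 - norm (\<psi> 0)) * (1 / 2)"
      by (intro mult_left_mono third_geometric_le) (use \<psi>1[of 0] in auto)
    finally show "(\<Sum>n\<le>N. norm (fps_nth C n) * r ^ n) \<le> 1" unfolding split by simp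
  qed (use r in auto)
  finally show ?thesis by (simp add: W)
qed

text \<open>
  A Gronwall argument for coefficients. The recursion turns into the differential inequality
  \<open>(r X)' \<le> P X\<close> for the partial sum \<open>X\<close> of the majorant series, with \<open>P\<close> the partial sum formed
  from \<open>p\<close>. Since \<open>P \<le> 1 + r \<Gamma>'\<close>, the product \<open>X exp (- \<Gamma>)\<close> is nonincreasing from the value \<open>1\<close>.
\<close>
lemma partial_sum_le_exp:
  fixes x p :: "nat \<Rightarrow> real" and \<Gamma> \<Gamma>' :: "real \<Rightarrow> real"
  assumes x: "x 0 = 1" "\<And>n. x n \<ge> 0" and p: "\<And>n. p n \<ge> 0"
    and rec: "\<And>n. real (Suc n) * x n \<le> (\<Sum>k\<le>n. p k * x (n - k))"
    and \<Gamma>: "\<Gamma> 0 = 0" "continuous_on {0..R} \<Gamma>" "\<And>r. 0 < r \<Longrightarrow> r < R \<Longrightarrow> (\<Gamma> has_real_derivative \<Gamma>' r) (at r)"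
    and pR: "\<And>r. 0 < r \<Longrightarrow> r < R \<Longrightarrow> (\<Sum>k\<le>N. p k * r ^ k) \<le> 1 + r * \<Gamma>' r"
    and R: "0 \<le> R"
  shows "(\<Sum>n\<le>N. x n * R ^ n) \<le> exp (\<Gamma> R)"
proof -
  define X where "X = (\<lambda>r. \<Sum>n\<le>N. x n * r ^ n)"
  define X' where "X' = (\<lambda>r. \<Sum>n\<le>N. x n * (real n * r ^ (n - 1)))"
  have dX: "(X has_real_derivative X' r) (at r)" for r
    unfolding X_def X'_def by (auto intro!: derivative_eq_intros sum.cong)
  define W where "W = (\<lambda>r. X r * exp (- \<Gamma> r))"
  have "W R \<le> W 0"
  proof (rule DERIV_nonpos_imp_decreasing_open[OF R])
    show "continuous_on {0..R} W"
      unfolding W_def X_def by (intro continuous_intros \<Gamma>)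
    fix r assume r: "0 < r" "r < R"
    have X0: "X r \<ge> 0" unfolding X_def using r x by (intro sum_nonneg) auto
    have "X r + r * X' r = (\<Sum>n\<le>N. (real (Suc n) * x n) * r ^ n)"
    proof -
      have "r * (real n * r ^ (n - 1)) = real n * r ^ n" for n by (cases n) auto
      then have "r * X' r = (\<Sum>n\<le>N. x n * (real n * r ^ n))"
        unfolding X'_def sum_distrib_left by (intro sum.cong refl) (metis mult.left_commute)
      then show ?thesis by (simp add: X_def sum.distrib[symmetric] algebra_simps)
    qed
    also have "\<dots> \<le> (\<Sum>n\<le>N. (\<Sum>k\<le>n. p k * x (n - k)) * r ^ n)"
      by (intro sum_mono mult_right_mono rec) (use r in auto)
    also have "\<dots> \<le> (\<Sum>k\<le>N. p k * r ^ k) * X r"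
      unfolding X_def by (rule convolution_partial_sum_le) (use p x r in auto)
    also have "\<dots> \<le> (1 + r * \<Gamma>' r) * X r" using pR[OF r] X0 by (intro mult_right_mono)
    finally have "r * X' r \<le> r * (\<Gamma>' r * X r)" by (simp add: algebra_simps)
    then have le: "X' r \<le> \<Gamma>' r * X r" using r by simp
    have "(W has_real_derivative X' r * exp (- \<Gamma> r) + X r * (exp (- \<Gamma> r) * (- \<Gamma>' r))) (at r)"
      unfolding W_def by (rule derivative_eq_intros dX \<Gamma>(3)[OF r] refl)+ simp
    moreover have "X' r * exp (- \<Gamma> r) + X r * (exp (- \<Gamma> r) * (- \<Gamma>' r)) = (X' r - \<Gamma>' r * X r) * exp (- \<Gamma> r)"
      by (simp add: algebra_simps)
    moreover have "\<dots> \<le> 0" using le by (intro mult_nonpos_nonneg) auto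
    ultimately show "\<exists>y. (W has_real_derivative y) (at r) \<and> y \<le> 0" by metis
  qed
  also have "W 0 = 1"
    unfolding W_def X_def using x(1) \<Gamma>(1) by (simp add: power_0_left sum.delta if_distrib cong: if_cong)
  finally show ?thesis by (simp add: W_def X_def exp_minus field_simps)
qed

section \<open>Averaging a function with its reflection\<close>

definition conj_mean :: "(complex \<Rightarrow> complex) \<Rightarrow> complex \<Rightarrow> complex" where
  "conj_mean F z = (F z + cnj (F (cnj z))) / 2"

lemma cnj_conj_mean: "cnj (conj_mean F (cnj z)) = conj_mean F z"
  by (simp add: conj_mean_def add.commute)

lemma Re_conj_mean: "Re (conj_mean F z) = (Re (F z) + Re (F (cnj z))) / 2"
  by (simp add: conj_mean_def)

lemma DERIV_conj_mean:
  assumes "F holomorphic_on ball 0 1" "z \<in> ball 0 1"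
  shows "(conj_mean F has_field_derivative conj_mean (deriv F) z) (at z)"
proof -
  have "cnj z \<in> ball 0 1" using assms(2) by simp
  from has_field_derivative_cnj_cnj[OF holomorphic_derivI[OF assms(1) open_ball this]]
  have 1: "((\<lambda>z. cnj (F (cnj z))) has_field_derivative cnj (deriv F (cnj z))) (at z)" by (simp add: o_def)
  show ?thesis
    unfolding conj_mean_def[abs_def]
    by (rule DERIV_cdivide[OF DERIV_add[OF holomorphic_derivI[OF assms(1) open_ball assms(2)] 1]])
qed

lemma holomorphic_conj_mean:
  "F holomorphic_on ball 0 1 \<Longrightarrow> conj_mean F holomorphic_on ball 0 1"
  unfolding holomorphic_on_open[OF open_ball] using DERIV_conj_mean holomorphic_on_open[OF open_ball] by blast

lemma mult_deriv_conj_mean: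
  assumes "F holomorphic_on ball 0 1" "z \<in> ball 0 1"
  shows "z * deriv (conj_mean F) z = conj_mean (\<lambda>z. z * deriv F z) z"
  using DERIV_imp_deriv[OF DERIV_conj_mean[OF assms]] by (simp add: conj_mean_def algebra_simps)

lemma fps_nth_conj_mean:
  assumes "F holomorphic_on ball 0 1"
  shows "fps_nth (fps_expansion (conj_mean F) 0) n = of_real (Re (fps_nth (fps_expansion F 0) n))"
proof -
  define A where "A = fps_expansion F 0"
  have sums: "(\<lambda>n. fps_nth A n * z ^ n) sums F z" if "norm z < 1" for z
  proof -
    have "F has_fps_expansion A"
      unfolding A_def by (rule has_fps_expansion_fps_expansion[OF open_ball _ assms]) simp
    then show ?thesis
      by (rule has_fps_expansion_imp_sums_complex[where r = "ereal 1"]) (use assms that in auto)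
  qed
  have "conj_mean F has_fps_expansion Abs_fps (\<lambda>n. of_real (Re (fps_nth A n)))"
  proof (rule has_fps_expansionI)
    have "eventually (\<lambda>z. z \<in> ball 0 1) (nhds (0::complex))" by (rule eventually_nhds_in_open) auto
    then show "\<forall>\<^sub>F z in nhds 0. (\<lambda>n. fps_nth (Abs_fps (\<lambda>n. of_real (Re (fps_nth A n)))) n * z ^ n) sums conj_mean F z"
    proof eventually_elim
      case (elim z)
      have "(\<lambda>n. cnj (fps_nth A n * cnj z ^ n)) sums cnj (F (cnj z))"
        using sums[of "cnj z"] elim unfolding sums_cnj by simp
      then have "(\<lambda>n. (fps_nth A n * z ^ n + cnj (fps_nth A n) * z ^ n) / 2) sums ((F z + cnj (F (cnj z))) / 2)"
        using elim by (intro sums_divide sums_add sums) auto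
      moreover have "(fps_nth A n * z ^ n + cnj (fps_nth A n) * z ^ n) / 2 = of_real (Re (fps_nth A n)) * z ^ n" for n
        by (simp add: distrib_right[symmetric] complex_add_cnj)
      ultimately show ?case by (simp add: conj_mean_def)
    qed
  qed
  then have "fps_expansion (conj_mean F) 0 = Abs_fps (\<lambda>n. of_real (Re (fps_nth A n)))"
    by (rule fps_expansion_eqI)
  then show ?thesis by (simp add: A_def)
qed

lemma coeff_of_mult_deriv_eq:
  assumes F: "F holomorphic_on ball 0 1" and g: "g holomorphic_on ball 0 1" and p: "p holomorphic_on ball 0 1"
    and eq: "\<And>z. z \<in> ball 0 1 \<Longrightarrow> z * deriv F z = g z * p z"
  shows "of_nat n * fps_nth (fps_expansion F 0) n =
    (\<Sum>k\<le>n. fps_nth (fps_expansion p 0) k * fps_nth (fps_expansion g 0) (n - k))"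
proof -
  have 0: "(0::complex) \<in> ball 0 1" by simp
  note [fps_expansion_intros] = has_fps_expansion_fps_expansion[OF open_ball 0 F]
    has_fps_expansion_fps_expansion[OF open_ball 0 g] has_fps_expansion_fps_expansion[OF open_ball 0 p]
  have "(\<lambda>z. z * deriv F z) has_fps_expansion fps_X * fps_deriv (fps_expansion F 0)"
    by (intro fps_expansion_intros)
  then have 1: "fps_expansion (\<lambda>z. z * deriv F z) 0 = fps_X * fps_deriv (fps_expansion F 0)"
    by (rule fps_expansion_eqI)
  have "(\<lambda>z. p z * g z) has_fps_expansion fps_expansion p 0 * fps_expansion g 0"
    by (intro fps_expansion_intros)
  then have 2: "fps_expansion (\<lambda>z. p z * g z) 0 = fps_expansion p 0 * fps_expansion g 0"
    by (rule fps_expansion_eqI)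
  have "eventually (\<lambda>z. z \<in> ball 0 1) (nhds (0::complex))" by (rule eventually_nhds_in_open) auto
  then have "\<forall>\<^sub>F z in nhds 0. z * deriv F z = p z * g z" by eventually_elim (simp add: eq mult.commute)
  then have "fps_X * fps_deriv (fps_expansion F 0) = fps_expansion p 0 * fps_expansion g 0"
    using fps_expansion_cong 1 2 by metis
  moreover have "fps_nth (fps_X * fps_deriv (fps_expansion F 0)) n = of_nat n * fps_nth (fps_expansion F 0) n"
    by (cases n) auto
  ultimately show ?thesis by (simp add: fps_mult_nth atLeast0AtMost)
qed

lemma conj_mean_normalized:
  assumes "f holomorphic_on ball 0 1" "f 0 = 0" "deriv f 0 = 1"
  shows "conj_mean f 0 = 0" "deriv (conj_mean f) 0 = 1"
  using DERIV_imp_deriv[OF DERIV_conj_mean[OF assms(1), of 0]] assms by (auto simp: conj_mean_def)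

text \<open>
  The function \<open>g = conj_mean f\<close> is its own reflection, so reflecting \<open>z f' = g p\<close> changes only \<open>f\<close> and \<open>p\<close>,
  and the two equations can be averaged. For \<open>p \<prec> \<phi>\<close> this mean need not be subordinate to \<open>\<phi>\<close>, as the image of \<open>\<phi>\<close> need
  not be convex; so only estimates that survive averaging can be used for \<open>g\<close>.
\<close>
lemma mult_deriv_conj_mean_starlike:
  assumes holf: "f holomorphic_on ball 0 1" and p: "\<And>z. z \<in> ball 0 1 \<Longrightarrow> z * deriv f z = conj_mean f z * p z"
    and z: "z \<in> ball 0 1"
  shows "z * deriv (conj_mean f) z = conj_mean f z * conj_mean p z"
proof -
  have "cnj z \<in> ball 0 1" using z by simp
  then have "cnj (cnj z * deriv f (cnj z)) = cnj (conj_mean f (cnj z) * p (cnj z))" using p by simp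
  then have "cnj (cnj z * deriv f (cnj z)) = conj_mean f z * cnj (p (cnj z))"
    using cnj_conj_mean[of f z] by simp
  then show ?thesis
    unfolding mult_deriv_conj_mean[OF holf z] using p[OF z] by (simp add: conj_mean_def[of p] conj_mean_def[of "\<lambda>z. z * deriv f z"] algebra_simps add_divide_distrib)
qed

section \<open>The extremal function\<close>

locale bohr_setting =
  fixes \<phi> h :: "complex \<Rightarrow> complex" and B :: "nat \<Rightarrow> real"
  assumes ma_minda: "ma_minda \<phi>"
    and series: "\<And>z. z \<in> unit_disc \<Longrightarrow> (\<lambda>n. complex_of_real (B (Suc n)) * z ^ Suc n) sums (\<phi> z - 1)"
    and B_pos: "\<And>n. n \<ge> 1 \<Longrightarrow> B n > 0"
    and min_modulus: "\<And>r::real. 0 < r \<Longrightarrow> r < 1 \<Longrightarrow>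
           complex_of_real (INF z\<in>sphere 0 r. norm (\<phi> z)) = \<phi> (- complex_of_real r)"
    and extremal: "ma_minda_extremal \<phi> h"
begin

lemma hol_phi: "\<phi> holomorphic_on ball 0 1" and inj_phi: "inj_on \<phi> (ball 0 1)" and phi_0: "\<phi> 0 = 1"
  and Re_phi_pos: "z \<in> ball 0 1 \<Longrightarrow> Re (\<phi> z) > 0"
proof -
  show "\<phi> holomorphic_on ball 0 1" "inj_on \<phi> (ball 0 1)" "\<phi> 0 = 1"
    using ma_minda by (simp_all add: ma_minda_def)
  have "\<phi> ` ball 0 1 \<subseteq> {w. Re w > 0}" using ma_minda by (simp add: ma_minda_def)
  then show "z \<in> ball 0 1 \<Longrightarrow> Re (\<phi> z) > 0" by blast
qed

lemma hol_h: "h holomorphic_on ball 0 1" and h_0: "h 0 = 0" and deriv_h_0: "deriv h 0 = 1"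
  and h_nonzero: "z \<in> ball 0 1 \<Longrightarrow> z \<noteq> 0 \<Longrightarrow> h z \<noteq> 0"
  and mult_deriv_h: "z \<in> ball 0 1 \<Longrightarrow> z * deriv h z = h z * \<phi> z"
proof -
  show "h holomorphic_on ball 0 1" "h 0 = 0" "deriv h 0 = 1"
    and nz: "z \<in> ball 0 1 \<Longrightarrow> z \<noteq> 0 \<Longrightarrow> h z \<noteq> 0"
    using extremal by (auto simp: ma_minda_extremal_def)
  show "z * deriv h z = h z * \<phi> z" if z: "z \<in> ball 0 1"
  proof (cases "z = 0")
    case False
    then have "z * deriv h z / h z = \<phi> z" "h z \<noteq> 0"
      using extremal z by (auto simp: ma_minda_extremal_def)
    then show ?thesis by (simp add: field_simps)
  qed (use \<open>h 0 = 0\<close> in simp)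
qed

lemma phi_cnj: "z \<in> ball 0 1 \<Longrightarrow> \<phi> (cnj z) = cnj (\<phi> z)"
proof -
  assume z: "z \<in> ball 0 1"
  have "(\<lambda>n. cnj (complex_of_real (B (Suc n)) * z ^ Suc n)) sums cnj (\<phi> z - 1)"
    unfolding sums_cnj by (rule series[OF z])
  then have "(\<lambda>n. complex_of_real (B (Suc n)) * cnj z ^ Suc n) sums cnj (\<phi> z - 1)" by simp
  moreover have "cnj z \<in> ball 0 1" using z by simp
  ultimately have "\<phi> (cnj z) - 1 = cnj (\<phi> z - 1)" using series sums_unique2 by blast
  then show ?thesis by simp
qed

definition phi_re :: "real \<Rightarrow> real" where "phi_re x = Re (\<phi> (of_real x))"

lemma phi_of_real: "\<bar>x\<bar> < 1 \<Longrightarrow> \<phi> (of_real x) = of_real (phi_re x)"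
  using phi_cnj[of "of_real x"] by (simp add: phi_re_def complex_eq_iff)

lemma phi_re_0: "phi_re 0 = 1"
  by (simp add: phi_re_def phi_0)

lemma phi_re_pos: "\<bar>x\<bar> < 1 \<Longrightarrow> phi_re x > 0"
  using Re_phi_pos[of "of_real x"] by (simp add: phi_re_def)

lemma phi_re_sums:
  assumes "\<bar>x\<bar> < 1"
  shows "(\<lambda>n. B (Suc n) * x ^ Suc n) sums (phi_re x - 1)"
proof -
  have "(\<lambda>n. Re (complex_of_real (B (Suc n)) * of_real x ^ Suc n)) sums Re (\<phi> (of_real x) - 1)"
    by (rule sums_Re[OF series]) (use assms in simp)
  moreover have "Re (complex_of_real (B (Suc n)) * of_real x ^ Suc n) = B (Suc n) * x ^ Suc n" for n
    by (simp only: of_real_power[symmetric] of_real_mult[symmetric] Re_complex_of_real)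
  ultimately show ?thesis by (simp add: phi_re_def)
qed

lemma phi_re_partial_sum_le:
  assumes "0 \<le> x" "x < 1"
  shows "1 + (\<Sum>n<N. B (Suc n) * x ^ Suc n) \<le> phi_re x"
proof -
  have s: "(\<lambda>n. B (Suc n) * x ^ Suc n) sums (phi_re x - 1)" using phi_re_sums assms by simp
  have "(\<Sum>n<N. B (Suc n) * x ^ Suc n) \<le> (\<Sum>n. B (Suc n) * x ^ Suc n)"
    by (rule sum_le_suminf[OF sums_summable[OF s]]) (use assms in \<open>auto intro!: mult_nonneg_nonneg less_imp_le[OF B_pos] simp del: power_Suc\<close>)
  then show ?thesis using sums_unique[OF s] by simp
qed

text \<open>
  A continuous injective function on an interval is monotone, and the positive coefficients decide
  the direction.
\<close>
lemma phi_re_strict_mono: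
  assumes "-1 < x" "x < y" "y < 1"
  shows "phi_re x < phi_re y"
proof -
  have cont: "continuous_on {-1<..<1} phi_re"
    unfolding phi_re_def
    by (intro continuous_intros continuous_on_compose2[OF holomorphic_on_imp_continuous_on[OF hol_phi]]) auto
  have "inj_on phi_re {-1<..<1}"
  proof (rule inj_onI)
    fix a b :: real assume ab: "a \<in> {-1<..<1}" "b \<in> {-1<..<1}" "phi_re a = phi_re b"
    then have "\<bar>a\<bar> < 1" "\<bar>b\<bar> < 1" by auto
    then have "\<phi> (of_real a) = \<phi> (of_real b)" using ab(3) by (simp add: phi_of_real)
    then have "complex_of_real a = of_real b"
      by (rule inj_onD[OF inj_phi]) (use \<open>\<bar>a\<bar> < 1\<close> \<open>\<bar>b\<bar> < 1\<close> in auto)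
    then show "a = b" by simp
  qed
  then have "strict_mono_on {-1<..<1} phi_re \<or> strict_antimono_on {-1<..<1} phi_re"
    using injective_eq_monotone_map[OF is_interval_oo cont] by blast
  moreover have "\<not> strict_antimono_on {-1<..<1} phi_re"
  proof
    assume "strict_antimono_on {-1<..<1} phi_re"
    then have "phi_re (1/2) < phi_re 0" by (rule monotone_onD) auto
    moreover have "1 + (\<Sum>n<1. B (Suc n) * (1/2) ^ Suc n) \<le> phi_re (1/2)" by (rule phi_re_partial_sum_le) auto
    ultimately show False using B_pos[of 1] by (simp add: phi_re_0)
  qed
  ultimately have "strict_mono_on {-1<..<1} phi_re" by blast
  then show ?thesis by (rule strict_mono_onD) (use assms in auto)
qed

lemma phi_re_mono: "-1 < x \<Longrightarrow> x \<le> y \<Longrightarrow> y < 1 \<Longrightarrow> phi_re x \<le> phi_re y"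
  using phi_re_strict_mono[of x y] by (cases "x = y") auto

lemma norm_phi_ge:
  assumes "norm z \<le> r" "r < 1"
  shows "phi_re (- r) \<le> norm (\<phi> z)"
proof -
  have "phi_re (- norm z) \<le> norm (\<phi> z)"
  proof (cases "z = 0")
    case True
    then show ?thesis by (simp add: phi_re_0 phi_0)
  next
    case False
    define s where "s = norm z"
    have s: "0 < s" "s < 1" using False assms by (auto simp: s_def)
    have "complex_of_real (INF z\<in>sphere 0 s. norm (\<phi> z)) = of_real (phi_re (- s))"
      using min_modulus[OF s] phi_of_real[of "- s"] s by simp
    then have "(INF z\<in>sphere 0 s. norm (\<phi> z)) = phi_re (- s)" by (simp only: of_real_eq_iff)
    moreover have "(INF z\<in>sphere 0 s. norm (\<phi> z)) \<le> norm (\<phi> z)"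
      by (rule cINF_lower) (auto simp: s_def intro!: bdd_belowI[of _ 0])
    ultimately show ?thesis by (simp add: s_def)
  qed
  moreover have "phi_re (- r) \<le> phi_re (- norm z)"
    using assms norm_ge_zero[of z] by (intro phi_re_mono) linarith+
  ultimately show ?thesis by simp
qed

lemma fps_nth_phi: "fps_nth (fps_expansion \<phi> 0) n = of_real (if n = 0 then 1 else B n)"
proof -
  have "\<phi> has_fps_expansion Abs_fps (\<lambda>n. of_real (if n = 0 then 1 else B n))"
  proof (rule has_fps_expansionI)
    have "eventually (\<lambda>z. z \<in> ball 0 1) (nhds (0::complex))" by (rule eventually_nhds_in_open) auto
    then show "\<forall>\<^sub>F z in nhds 0. (\<lambda>n. fps_nth (Abs_fps (\<lambda>n. of_real (if n = 0 then 1 else B n))) n * z ^ n) sums \<phi> z"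
    proof eventually_elim
      case (elim z)
      have "(\<lambda>n. complex_of_real (if n = 0 then 1 else B n) * z ^ n) sums (\<phi> z - 1 + complex_of_real (if (0::nat) = 0 then 1 else B 0) * z ^ 0)"
        by (rule iffD1[OF sums_Suc_iff]) (use series[OF elim] in simp)
      then show ?case by simp
    qed
  qed
  from fps_expansion_eqI[OF this] show ?thesis by simp
qed

text \<open>
  The primitive of \<open>(\<phi> z - 1) / z\<close> that vanishes at \<open>0\<close>, that is, the logarithm of \<open>h z / z\<close>.
\<close>
definition G :: "complex \<Rightarrow> complex" where
  "G = (SOME \<Lambda>. \<Lambda> holomorphic_on ball 0 1 \<and> \<Lambda> 0 = 0 \<and> (\<forall>z\<in>ball 0 1. z * deriv \<Lambda> z = \<phi> z - 1))"

lemma hol_G: "G holomorphic_on ball 0 1" and G_0: "G 0 = 0"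
  and mult_deriv_G: "z \<in> ball 0 1 \<Longrightarrow> z * deriv G z = \<phi> z - 1"
proof -
  have "\<exists>\<Lambda>. \<Lambda> holomorphic_on ball 0 1 \<and> \<Lambda> 0 = 0 \<and> (\<forall>z\<in>ball 0 1. z * deriv \<Lambda> z = \<phi> z - 1)"
    using log_primitive_exists[OF hol_phi phi_0] by metis
  from someI_ex[OF this]
  show "G holomorphic_on ball 0 1" "G 0 = 0" "z \<in> ball 0 1 \<Longrightarrow> z * deriv G z = \<phi> z - 1"
    unfolding G_def[symmetric] by auto
qed

lemma G_conj_mean: "z \<in> ball 0 1 \<Longrightarrow> conj_mean G z = G z"
proof (rule log_primitive_unique[where q = \<phi> and \<Lambda> = "conj_mean G" and \<Theta> = G])
  show "w * deriv (conj_mean G) w = \<phi> w - 1" if w: "w \<in> ball 0 1" for w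
  proof -
    have "cnj w * deriv G (cnj w) = cnj (\<phi> w) - 1"
      using mult_deriv_G[of "cnj w"] w phi_cnj[OF w] by simp
    then show ?thesis
      unfolding mult_deriv_conj_mean[OF hol_G w] conj_mean_def mult_deriv_G[OF w] by simp
  qed
qed (simp_all add: hol_G G_0 mult_deriv_G holomorphic_conj_mean, simp add: conj_mean_def G_0)

definition \<Gamma> :: "real \<Rightarrow> real" where "\<Gamma> x = Re (G (of_real x))"

lemma G_of_real: "\<bar>x\<bar> < 1 \<Longrightarrow> G (of_real x) = of_real (\<Gamma> x)"
  using G_conj_mean[of "of_real x"] by (simp add: conj_mean_def \<Gamma>_def complex_eq_iff)

lemma \<Gamma>_0: "\<Gamma> 0 = 0"
  by (simp add: \<Gamma>_def G_0)

lemma DERIV_\<Gamma>: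
  assumes "\<bar>x\<bar> < 1"
  shows "(\<Gamma> has_real_derivative Re (deriv G (of_real x))) (at x)"
proof -
  have x: "complex_of_real x \<in> ball 0 1" using assms by simp
  have "(complex_of_real has_vector_derivative 1) (at x)"
    by (auto intro!: derivative_eq_intros)
  from field_vector_diff_chain_at[OF this holomorphic_derivI[OF hol_G open_ball x]]
  show ?thesis by (simp add: o_def \<Gamma>_def[abs_def] has_vector_derivative_complex_iff)
qed

lemma mult_deriv_\<Gamma>: "\<bar>x\<bar> < 1 \<Longrightarrow> x * Re (deriv G (of_real x)) = phi_re x - 1"
  using arg_cong[OF mult_deriv_G[of "of_real x"], of Re] by (simp add: phi_re_def)

lemma continuous_\<Gamma>: "continuous_on {-1<..<1} \<Gamma>"
  by (rule DERIV_continuous_on[of _ _ "\<lambda>x. Re (deriv G (of_real x))"])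
     (auto intro!: has_field_derivative_at_within DERIV_\<Gamma>)

text \<open>
  The derivative \<open>(phi_re x - 1) / x\<close> is positive off \<open>0\<close>; intervals with \<open>0\<close> in their interior are
  left out to keep the quotient away from its singularity.
\<close>
lemma \<Gamma>_strict_mono:
  assumes "-1 < a" "a < b" "b < 1" "b \<le> 0 \<or> 0 \<le> a"
  shows "\<Gamma> a < \<Gamma> b"
proof (rule DERIV_pos_imp_increasing_open[OF assms(2)])
  show "continuous_on {a..b} \<Gamma>" by (rule continuous_on_subset[OF continuous_\<Gamma>]) (use assms in auto)
  fix x assume x: "a < x" "x < b"
  then have x1: "\<bar>x\<bar> < 1" using assms by auto
  have "x * Re (deriv G (of_real x)) = phi_re x - 1" by (rule mult_deriv_\<Gamma>[OF x1])
  moreover have "x < 0 \<and> phi_re x < 1 \<or> 0 < x \<and> phi_re x > 1"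
    using assms x phi_re_strict_mono[of x 0] phi_re_strict_mono[of 0 x] x1 by (auto simp: phi_re_0)
  ultimately have "Re (deriv G (of_real x)) > 0"
    by (metis diff_gt_0_iff_gt diff_less_0_iff_less zero_less_mult_iff mult_less_0_iff less_asym)
  then show "\<exists>y. (\<Gamma> has_real_derivative y) (at x) \<and> 0 < y" using DERIV_\<Gamma>[OF x1] by blast
qed

lemma h_eq: "z \<in> ball 0 1 \<Longrightarrow> h z = z * exp (G z)"
  by (rule eq_mult_exp_log_primitive[where q = \<phi>])
     (simp_all add: hol_h h_0 deriv_h_0 mult_deriv_h hol_G G_0 mult_deriv_G)

definition H :: "real \<Rightarrow> real" where "H x = x * exp (\<Gamma> x)"

lemma h_of_real: "\<bar>x\<bar> < 1 \<Longrightarrow> h (of_real x) = of_real (H x)"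
  by (simp add: h_eq G_of_real H_def exp_of_real)

text \<open>
  The lower growth function \<open>- h (- r)\<close>.
\<close>
definition M :: "real \<Rightarrow> real" where "M r = r * exp (\<Gamma> (- r))"

lemma h_minus: "\<bar>r\<bar> < 1 \<Longrightarrow> h (- of_real r) = - of_real (M r)"
  using h_of_real[of "- r"] by (simp add: H_def M_def)

lemma DERIV_M:
  assumes "\<bar>r\<bar> < 1"
  shows "(M has_real_derivative exp (\<Gamma> (- r)) * phi_re (- r)) (at r)"
proof -
  have r: "\<bar>- r\<bar> < 1" using assms by simp
  have d: "((\<lambda>r. \<Gamma> (- r)) has_real_derivative Re (deriv G (of_real (- r))) * (- 1)) (at r)"
    by (rule DERIV_chain2[where f = \<Gamma> and g = uminus, OF DERIV_\<Gamma>[OF r]]) (auto intro!: derivative_eq_intros)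
  have "(M has_real_derivative exp (\<Gamma> (- r)) + r * (exp (\<Gamma> (- r)) * (Re (deriv G (of_real (- r))) * (- 1)))) (at r)"
    unfolding M_def[abs_def] by (rule derivative_eq_intros d refl)+ simp
  moreover have "exp (\<Gamma> (- r)) + r * (exp (\<Gamma> (- r)) * (Re (deriv G (of_real (- r))) * (- 1))) = exp (\<Gamma> (- r)) * phi_re (- r)"
    using mult_deriv_\<Gamma>[OF r] by algebra
  ultimately show ?thesis by simp
qed

lemma M_strict_mono:
  assumes "-1 < a" "a < b" "b < 1"
  shows "M a < M b"
proof (rule DERIV_pos_imp_increasing[OF assms(2)])
  fix x assume "a \<le> x" "x \<le> b"
  then have "\<bar>x\<bar> < 1" using assms by auto
  then show "\<exists>y. (M has_real_derivative y) (at x) \<and> 0 < y"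
    using DERIV_M[of x] phi_re_pos[of "- x"] by (metis abs_minus exp_gt_zero mult_pos_pos)
qed

text \<open>
  The number \<open>- h (-1)\<close> as a radial limit.
\<close>
definition L :: real where "L = (SUP r\<in>{0<..<1}. M r)"

lemma M_le_exp: "0 < r \<Longrightarrow> r < 1 \<Longrightarrow> M r \<le> exp (\<Gamma> (- (1/2)))"
proof -
  have half: "M r \<le> exp (\<Gamma> (- (1/2)))" if r: "1/2 \<le> r" "r < 1" for r
  proof -
    have "\<Gamma> (- r) \<le> \<Gamma> (- (1/2))"
    proof (cases "1/2 < r")
      case True
      then show ?thesis using \<Gamma>_strict_mono[of "- r" "- (1/2)"] r by simp
    next
      case False
      then have "r = 1/2" using r by linarith
      then show ?thesis by (simp only: order_refl)
    qed
    then have "r * exp (\<Gamma> (- r)) \<le> 1 * exp (\<Gamma> (- (1/2)))" using r by (intro mult_mono) auto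
    then show ?thesis by (simp add: M_def)
  qed
  assume r: "0 < r" "r < 1"
  show ?thesis
  proof (cases "1/2 \<le> r")
    case False
    then have "M r < M (1/2)" by (intro M_strict_mono) (use r in auto)
    also have "\<dots> \<le> exp (\<Gamma> (- (1/2)))" by (rule half) auto
    finally show ?thesis by simp
  qed (use half r in simp)
qed

lemma bdd_M: "bdd_above (M ` {0<..<1})"
  using M_le_exp by (intro bdd_aboveI[of _ "exp (\<Gamma> (- (1/2)))"]) auto

lemma M_le_L: "0 < r \<Longrightarrow> r < 1 \<Longrightarrow> M r \<le> L"
  unfolding L_def by (rule cSUP_upper[OF _ bdd_M]) simp

lemma L_pos: "0 < L" and L_less_1: "L < 1"
proof -
  have "0 < M (1/2)" by (simp add: M_def)
  then show "0 < L" using M_le_L[of "1/2"] by simp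
  have "L \<le> exp (\<Gamma> (- (1/2)))" unfolding L_def by (rule cSUP_least) (auto intro: M_le_exp)
  also have "\<dots> < 1" using \<Gamma>_strict_mono[of "- (1/2)" 0] by (simp add: \<Gamma>_0)
  finally show "L < 1" .
qed

lemma M_tendsto: "(M \<longlongrightarrow> L) (at_left 1)"
proof (rule increasing_tendsto)
  have ev: "\<forall>\<^sub>F r in at_left (1::real). r \<in> {0<..<1}" by (rule eventually_at_left_real) simp
  then show "\<forall>\<^sub>F r in at_left 1. M r \<le> L" by eventually_elim (auto intro: M_le_L)
  fix x assume "x < L"
  then obtain r0 where r0: "0 < r0" "r0 < 1" "x < M r0"
    unfolding L_def by (subst (asm) less_cSUP_iff[OF _ bdd_M]) auto
  have "\<forall>\<^sub>F r in at_left (1::real). r \<in> {r0<..<1}" by (rule eventually_at_left_real) (use r0 in simp)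
  then show "\<forall>\<^sub>F r in at_left 1. x < M r"
  proof eventually_elim
    case (elim r)
    then show ?case using M_strict_mono[of r0 r] r0 by auto
  qed
qed

lemma h_minus_tendsto: "((\<lambda>r::real. h (- of_real r)) \<longlongrightarrow> - of_real L) (at_left 1)"
proof -
  have "((\<lambda>r. - complex_of_real (M r)) \<longlongrightarrow> - of_real L) (at_left 1)"
    by (intro tendsto_intros M_tendsto)
  moreover have "\<forall>\<^sub>F r in at_left (1::real). - complex_of_real (M r) = h (- of_real r)"
    using eventually_at_left_real[of 0 "1::real", OF zero_less_one] by eventually_elim (auto simp: h_minus)
  ultimately show ?thesis by (rule Lim_transform_eventually)
qed

lemma value_at_minus_one_h: "value_at_minus_one h = - of_real L"
  unfolding value_at_minus_one_def by (rule tendsto_Lim[OF _ h_minus_tendsto]) simp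

lemma H_strict_mono:
  assumes "0 \<le> a" "a < b" "b < 1"
  shows "H a < H b"
proof -
  have "\<Gamma> a < \<Gamma> b" using \<Gamma>_strict_mono assms by simp
  then show ?thesis unfolding H_def using assms
    by (intro mult_strict_mono) auto
qed

lemma H_mono: "0 \<le> a \<Longrightarrow> a \<le> b \<Longrightarrow> b < 1 \<Longrightarrow> H a \<le> H b"
  using H_strict_mono[of a b] by (cases "a = b") auto

lemma is_bohr_root_iff: "is_bohr_root h r \<longleftrightarrow> 0 < r \<and> r < 1 \<and> H r = L"
proof -
  have "h (of_real r) + value_at_minus_one h = 0 \<longleftrightarrow> H r = L" if "0 < r" "r < 1"
  proof -
    have "h (of_real r) + value_at_minus_one h = of_real (H r - L)"
      using that by (simp add: h_of_real value_at_minus_one_h)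
    then show ?thesis by (simp only: of_real_eq_0_iff) simp
  qed
  then show ?thesis unfolding is_bohr_root_def by blast
qed

text \<open>
  \<open>H\<close> increases strictly from \<open>H 0 = 0\<close>, and \<open>H L > L\<close> because \<open>\<Gamma>\<close> is positive on \<open>(0, 1)\<close>; so the root lies
  below \<open>L < 1\<close>.
\<close>
lemma ex1_bohr_root: "\<exists>!r. is_bohr_root h r"
proof -
  have "\<exists>r. 0 \<le> r \<and> r \<le> L \<and> H r = L"
  proof (rule IVT')
    have "\<Gamma> 0 < \<Gamma> L" by (rule \<Gamma>_strict_mono) (use L_pos L_less_1 in auto)
    then have "L * 1 \<le> L * exp (\<Gamma> L)" using L_pos by (intro mult_left_mono) (auto simp: \<Gamma>_0)
    then show "L \<le> H L" by (simp add: H_def)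
    show "continuous_on {0..L} H"
      unfolding H_def by (intro continuous_intros continuous_on_subset[OF continuous_\<Gamma>]) (use L_less_1 in auto)
  qed (use L_pos in \<open>auto simp: H_def\<close>)
  then obtain r where r: "0 \<le> r" "r \<le> L" "H r = L" by blast
  have "r \<noteq> 0" using r(3) L_pos by (auto simp: H_def)
  then have r1: "is_bohr_root h r" using r L_less_1 by (simp add: is_bohr_root_iff)
  show ?thesis
  proof (rule ex1I[where P = "is_bohr_root h", OF r1])
    fix s assume "is_bohr_root h s"
    then show "s = r" using r1 H_strict_mono[of r s] H_strict_mono[of s r]
      by (auto simp: is_bohr_root_iff dest: linorder_neqE)
  qed
qed

lemma bohr_radius_root: "0 < bohr_radius h" "bohr_radius h < 1" "H (bohr_radius h) = L"
proof -
  have "is_bohr_root h (bohr_radius h)" unfolding bohr_radius_def by (rule theI'[OF ex1_bohr_root])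
  then show "0 < bohr_radius h" "bohr_radius h < 1" "H (bohr_radius h) = L"
    by (simp_all add: is_bohr_root_iff)
qed

section \<open>Functions starlike with respect to conjugate points\<close>

text \<open>
  A zero of \<open>conj_mean f\<close> off the origin would make \<^const>\<open>conj_quotient\<close> vanish there, by the convention
  \<open>x / 0 = 0\<close>; but \<open>\<phi>\<close> has no zeros.
\<close>
lemma starlike_conjE:
  assumes "f \<in> starlike_conj \<phi>"
  obtains \<omega> where "\<omega> holomorphic_on ball 0 1" "\<omega> 0 = 0" "\<And>z. norm z < 1 \<Longrightarrow> norm (\<omega> z) < 1"
    "\<And>z. z \<in> ball 0 1 \<Longrightarrow> norm (\<omega> z) \<le> norm z"
    "\<And>z. z \<in> ball 0 1 \<Longrightarrow> z \<noteq> 0 \<Longrightarrow> conj_mean f z \<noteq> 0"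
    "\<And>z. z \<in> ball 0 1 \<Longrightarrow> z * deriv f z = conj_mean f z * \<phi> (\<omega> z)"
proof -
  have "subordinate (conj_quotient f) \<phi>" and A: "f \<in> class_A" using assms by (auto simp: starlike_conj_def)
  then obtain \<omega> where \<omega>: "\<omega> holomorphic_on ball 0 1" "\<omega> ` ball 0 1 \<subseteq> ball 0 1" "\<omega> 0 = 0"
      "\<And>z. z \<in> ball 0 1 \<Longrightarrow> conj_quotient f z = \<phi> (\<omega> z)"
    unfolding subordinate_def by blast
  have lt: "norm (\<omega> z) < 1" if "norm z < 1" for z
  proof -
    have "z \<in> ball 0 1" using that by simp
    then have "\<omega> z \<in> ball 0 1" using \<omega>(2) by blast
    then show ?thesis by simp
  qed
  have quot: "conj_quotient f z = z * deriv f z / conj_mean f z" if "z \<noteq> 0" for z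
    using that by (simp add: conj_quotient_def conj_mean_def)
  have nz: "conj_mean f z \<noteq> 0" if z: "z \<in> ball 0 1" "z \<noteq> 0" for z
  proof
    assume "conj_mean f z = 0"
    then have "\<phi> (\<omega> z) = 0" using quot \<omega>(4)[OF z(1)] z(2) by simp
    then show False using Re_phi_pos[of "\<omega> z"] lt[of z] z by simp
  qed
  show ?thesis
  proof (rule that[OF \<omega>(1,3) lt _ nz])
    show "norm (\<omega> z) \<le> norm z" if "z \<in> ball 0 1" for z
      using Schwarz_Lemma(1)[OF \<omega>(1,3) lt] that by simp
    show "z * deriv f z = conj_mean f z * \<phi> (\<omega> z)" if z: "z \<in> ball 0 1" for z
    proof (cases "z = 0")
      case True
      then show ?thesis using A by (simp add: conj_mean_def class_A_def)
    next
      case False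
      then show ?thesis using quot[OF False] \<omega>(4)[OF z] nz[OF z False] by (simp add: field_simps)
    qed
  qed
qed

lemma starlike_conj_normalized: "f \<in> starlike_conj \<phi> \<Longrightarrow> f holomorphic_on ball 0 1 \<and> f 0 = 0 \<and> deriv f 0 = 1"
  by (simp add: starlike_conj_def class_A_def)

lemma starlike_conj_inj_on:
  assumes f: "f \<in> starlike_conj \<phi>"
  shows "inj_on f (ball 0 1)"
proof -
  obtain \<omega> where \<omega>: "\<omega> holomorphic_on ball 0 1" "\<omega> 0 = 0" "\<And>z. norm z < 1 \<Longrightarrow> norm (\<omega> z) < 1"
    "\<And>z. z \<in> ball 0 1 \<Longrightarrow> norm (\<omega> z) \<le> norm z"
    "\<And>z. z \<in> ball 0 1 \<Longrightarrow> z \<noteq> 0 \<Longrightarrow> conj_mean f z \<noteq> 0"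
    "\<And>z. z \<in> ball 0 1 \<Longrightarrow> z * deriv f z = conj_mean f z * \<phi> (\<omega> z)"
    using starlike_conjE[OF f] by metis
  note A = starlike_conj_normalized[OF f]
  have pos: "Re (\<phi> (\<omega> z)) > 0" if "z \<in> ball 0 1" for z
    using Re_phi_pos[of "\<omega> z"] \<omega>(3)[of z] that by simp
  show ?thesis
  proof (rule close_to_convex_inj_on[where g = "conj_mean f"])
    fix z :: complex assume z: "z \<in> ball 0 1" "z \<noteq> 0"
    show "conj_mean f z \<noteq> 0" using \<omega>(5) z by blast
    then show "Re (z * deriv f z / conj_mean f z) > 0"
      using \<omega>(6)[OF z(1)] pos[OF z(1)] by simp
    have "z * deriv (conj_mean f) z = conj_mean f z * conj_mean (\<lambda>z. \<phi> (\<omega> z)) z"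
      by (rule mult_deriv_conj_mean_starlike) (use A \<omega>(6) z in auto)
    moreover have "Re (conj_mean (\<lambda>z. \<phi> (\<omega> z)) z) > 0"
      unfolding Re_conj_mean using pos[OF z(1)] pos[of "cnj z"] z by simp
    ultimately show "Re (z * deriv (conj_mean f) z / conj_mean f z) > 0"
      using \<open>conj_mean f z \<noteq> 0\<close> by simp
  qed (use A conj_mean_normalized holomorphic_conj_mean in auto)
qed

text \<open>
  The distortion theorem \<open>norm (f' z) \<ge> h'(- norm z)\<close>. With \<open>z f' = g p\<close>, the factor \<open>p = \<phi> \<circ> \<omega>\<close> is
  bounded below by the minimum modulus hypothesis. The factor \<open>g\<close> equals \<open>z\<close> times the exponential of the conjugate
  mean of the logarithmic primitive of \<open>p\<close>, and the lower bound on the real part of that primitive passes to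
  the mean.
\<close>
lemma norm_deriv_starlike_conj_ge:
  assumes f: "f \<in> starlike_conj \<phi>" and z: "z \<in> ball 0 1" "z \<noteq> 0"
  shows "exp (\<Gamma> (- norm z)) * phi_re (- norm z) \<le> norm (deriv f z)"
proof -
  obtain \<omega> where \<omega>: "\<omega> holomorphic_on ball 0 1" "\<omega> 0 = 0" "\<And>z. norm z < 1 \<Longrightarrow> norm (\<omega> z) < 1"
    "\<And>z. z \<in> ball 0 1 \<Longrightarrow> norm (\<omega> z) \<le> norm z"
    "\<And>z. z \<in> ball 0 1 \<Longrightarrow> z \<noteq> 0 \<Longrightarrow> conj_mean f z \<noteq> 0"
    "\<And>z. z \<in> ball 0 1 \<Longrightarrow> z * deriv f z = conj_mean f z * \<phi> (\<omega> z)"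
    using starlike_conjE[OF f] by metis
  note A = starlike_conj_normalized[OF f]
  define p where "p = (\<lambda>z. \<phi> (\<omega> z))"
  have holp: "p holomorphic_on ball 0 1"
    unfolding p_def by (rule holomorphic_on_compose_gen[OF \<omega>(1) hol_phi, unfolded o_def]) (use \<omega>(3) in auto)
  have p0: "p 0 = 1" by (simp add: p_def \<omega>(2) phi_0)
  obtain K where K: "K holomorphic_on ball 0 1" "K 0 = 0" "\<And>z. z \<in> ball 0 1 \<Longrightarrow> z * deriv K z = p z - 1"
    using log_primitive_exists[OF holp p0] by metis
  have Kge: "\<Gamma> (- norm w) \<le> Re (K w)" if w: "w \<in> ball 0 1" for w
  proof -
    have "Re (G (- of_real (norm w))) \<le> Re (K w)"
      by (rule Re_log_primitive_subordinate_ge[OF inj_phi phi_cnj _ \<omega>(4) K(1,2) K(3)[unfolded p_def] hol_G G_0 mult_deriv_G w])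
         (use phi_re_mono in \<open>auto simp: phi_re_def\<close>)
    then show ?thesis by (simp add: \<Gamma>_def)
  qed
  have K0: "conj_mean K 0 = 0" by (simp add: conj_mean_def K(2))
  have "conj_mean f z = z * exp (conj_mean K z)"
  proof (rule eq_mult_exp_log_primitive[where q = "conj_mean p"])
    show "w * deriv (conj_mean f) w = conj_mean f w * conj_mean p w" if "w \<in> ball 0 1" for w
      by (rule mult_deriv_conj_mean_starlike) (use A \<omega>(6) that in \<open>auto simp: p_def\<close>)
    show "w * deriv (conj_mean K) w = conj_mean p w - 1" if w: "w \<in> ball 0 1" for w
    proof -
      have "cnj (cnj w * deriv K (cnj w)) = cnj (p (cnj w)) - 1" using K(3)[of "cnj w"] w by simp
      then show ?thesis
        unfolding mult_deriv_conj_mean[OF K(1) w] conj_mean_def K(3)[OF w] by simp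
    qed
  qed (use A conj_mean_normalized holomorphic_conj_mean K(1) K0 z in auto)
  then have "norm (conj_mean f z) = norm z * exp (Re (conj_mean K z))" by (simp add: norm_mult)
  moreover have "Re (conj_mean K z) \<ge> \<Gamma> (- norm z)"
    unfolding Re_conj_mean using Kge[OF z(1)] Kge[of "cnj z"] z(1) by simp
  ultimately have ge: "norm (conj_mean f z) \<ge> norm z * exp (\<Gamma> (- norm z))"
    by (simp add: mult_left_mono)
  have "norm z * (exp (\<Gamma> (- norm z)) * phi_re (- norm z)) = (norm z * exp (\<Gamma> (- norm z))) * phi_re (- norm z)" by simp
  also have "\<dots> \<le> norm (conj_mean f z) * norm (\<phi> (\<omega> z))"
    using ge norm_phi_ge[OF \<omega>(4)[OF z(1)]] phi_re_pos[of "- norm z"] z by (intro mult_mono) auto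
  also have "\<dots> = norm z * norm (deriv f z)" using arg_cong[OF \<omega>(6)[OF z(1)], of norm] by (simp add: norm_mult)
  finally show ?thesis using z(2) by simp
qed

lemma L_le_boundary_dist:
  assumes f: "f \<in> starlike_conj \<phi>"
  shows "L \<le> boundary_dist f"
  unfolding L_def
proof (rule cSUP_least)
  fix \<rho> :: real assume \<rho>: "\<rho> \<in> {0<..<1}"
  note A = starlike_conj_normalized[OF f]
  show "M \<rho> \<le> boundary_dist f"
  proof (rule boundary_dist_ge_of_deriv_ge[OF _ starlike_conj_inj_on[OF f], where M = M and \<rho> = \<rho> and M' = "\<lambda>r. exp (\<Gamma> (- r)) * phi_re (- r)"])
    show "continuous_on {0..<1} M"
      unfolding M_def by (intro continuous_intros continuous_on_compose2[OF continuous_\<Gamma>]) auto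
    show "(M has_real_derivative exp (\<Gamma> (- r)) * phi_re (- r)) (at r)" if "0 < r" "r < 1" for r
      using DERIV_M that by simp
    show "0 < exp (\<Gamma> (- r)) * phi_re (- r)" if "0 < r" "r < 1" for r
      using phi_re_pos[of "- r"] that by simp
  qed (use A \<rho> norm_deriv_starlike_conj_ge[OF f] in \<open>auto simp: M_def\<close>)
qed simp

text \<open>
  Compare coefficients in \<open>z f' = g p\<close>. The coefficients of \<open>g = conj_mean f\<close> are the real parts of those
  of \<open>f\<close>, hence no larger, so the moduli of the coefficients of \<open>f\<close> satisfy the recursion of
  \<open>partial_sum_le_exp\<close>, with the majorant of \<open>p \<prec> \<phi>\<close> bounded by \<open>\<phi>\<close> up to radius \<open>1/3\<close>.
\<close>
lemma partial_majorant_le_H: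
  assumes f: "f \<in> starlike_conj \<phi>" and r: "0 \<le> r" "r \<le> 1/3"
  shows "(\<Sum>n\<le>N. norm (taylor_coeff f (Suc n)) * r ^ Suc n) \<le> H r"
proof -
  obtain \<omega> where \<omega>: "\<omega> holomorphic_on ball 0 1" "\<omega> 0 = 0" "\<And>z. norm z < 1 \<Longrightarrow> norm (\<omega> z) < 1"
    "\<And>z. z \<in> ball 0 1 \<Longrightarrow> norm (\<omega> z) \<le> norm z"
    "\<And>z. z \<in> ball 0 1 \<Longrightarrow> z \<noteq> 0 \<Longrightarrow> conj_mean f z \<noteq> 0"
    "\<And>z. z \<in> ball 0 1 \<Longrightarrow> z * deriv f z = conj_mean f z * \<phi> (\<omega> z)"
    using starlike_conjE[OF f] by metis
  note A = starlike_conj_normalized[OF f]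
  define p where "p = (\<lambda>z. \<phi> (\<omega> z))"
  have holp: "p holomorphic_on ball 0 1"
    unfolding p_def by (rule holomorphic_on_compose_gen[OF \<omega>(1) hol_phi, unfolded o_def]) (use \<omega>(3) in auto)
  have f0: "taylor_coeff f 0 = 0" and f1: "taylor_coeff f 1 = 1" using A by (simp_all add: fps_expansion_def)
  have W: "\<omega> has_fps_expansion fps_expansion \<omega> 0"
    by (rule has_fps_expansion_fps_expansion[OF open_ball _ \<omega>(1)]) simp
  have "\<phi> has_fps_expansion fps_expansion \<phi> 0"
    by (rule has_fps_expansion_fps_expansion[OF open_ball _ hol_phi]) simp
  then have "(\<phi> \<circ> \<omega>) has_fps_expansion (fps_expansion \<phi> 0 oo fps_expansion \<omega> 0)"
    by (rule has_fps_expansion_compose[OF _ W]) (simp add: fps_expansion_def \<omega>(2))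
  then have P: "fps_expansion p 0 = fps_expansion \<phi> 0 oo fps_expansion \<omega> 0"
    unfolding p_def using fps_expansion_eqI by (simp add: o_def)
  have phi_bound: "majorant N s (fps_expansion p 0) \<le> phi_re s" if s: "0 \<le> s" "s \<le> 1/3" for s
  proof -
    have "majorant N s (fps_expansion p 0) \<le> majorant N s (fps_expansion \<phi> 0)"
      unfolding P by (intro majorant_compose_le majorant_Schwarz_function_le \<omega> s)
    also have "\<dots> = 1 + (\<Sum>n<N. B (Suc n) * s ^ Suc n)"
      unfolding majorant_def fps_nth_phi lessThan_Suc_atMost[symmetric]
      by (subst sum.lessThan_Suc_shift) (simp add: abs_of_pos B_pos)
    also have "\<dots> \<le> phi_re s" by (rule phi_re_partial_sum_le) (use s in auto)
    finally show ?thesis .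
  qed
  have rec: "real (Suc n) * norm (taylor_coeff f (Suc n)) \<le> (\<Sum>k\<le>n. norm (taylor_coeff p k) * norm (taylor_coeff f (Suc (n - k))))" for n
  proof -
    have "of_nat (Suc n) * taylor_coeff f (Suc n) = (\<Sum>k\<le>Suc n. taylor_coeff p k * taylor_coeff (conj_mean f) (Suc n - k))"
      by (rule coeff_of_mult_deriv_eq) (use A \<omega>(6) holp holomorphic_conj_mean in \<open>auto simp: p_def\<close>)
    also have "\<dots> = (\<Sum>k\<le>n. taylor_coeff p k * of_real (Re (taylor_coeff f (Suc (n - k)))))"
      using A by (simp add: fps_nth_conj_mean f0 Suc_diff_le)
    finally have "norm (of_nat (Suc n) * taylor_coeff f (Suc n)) = norm (\<Sum>k\<le>n. taylor_coeff p k * of_real (Re (taylor_coeff f (Suc (n - k)))))"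
      by simp
    also have "\<dots> \<le> (\<Sum>k\<le>n. norm (taylor_coeff p k) * norm (taylor_coeff f (Suc (n - k))))"
      by (intro order.trans[OF norm_sum] sum_mono) (auto simp: norm_mult intro!: mult_left_mono abs_Re_le_cmod)
    finally show ?thesis by (simp only: norm_mult norm_of_nat)
  qed
  have "(\<Sum>n\<le>N. norm (taylor_coeff f (Suc n)) * r ^ n) \<le> exp (\<Gamma> r)"
  proof (rule partial_sum_le_exp[where p = "\<lambda>k. norm (taylor_coeff p k)" and \<Gamma>' = "\<lambda>x. Re (deriv G (of_real x))"])
    show "continuous_on {0..r} \<Gamma>" by (rule continuous_on_subset[OF continuous_\<Gamma>]) (use r in auto)
    show "(\<Gamma> has_real_derivative Re (deriv G (of_real s))) (at s)" if "0 < s" "s < r" for s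
      using DERIV_\<Gamma> that r by simp
    show "(\<Sum>k\<le>N. norm (taylor_coeff p k) * s ^ k) \<le> 1 + s * Re (deriv G (of_real s))" if "0 < s" "s < r" for s
      using phi_bound[of s] mult_deriv_\<Gamma>[of s] that r by (simp add: majorant_def)
  qed (use f1 \<Gamma>_0 r rec in auto)
  then have "r * (\<Sum>n\<le>N. norm (taylor_coeff f (Suc n)) * r ^ n) \<le> r * exp (\<Gamma> r)" using r by (intro mult_left_mono)
  then show ?thesis by (simp add: H_def sum_distrib_left mult_ac)
qed

lemma bohr_sum_le_H:
  assumes f: "f \<in> starlike_conj \<phi>" and z: "norm z \<le> 1/3"
  shows "summable (\<lambda>n. norm (taylor_coeff f (n + 2)) * norm z ^ (n + 2))" "bohr_sum f z \<le> H (norm z)"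
proof -
  have f1: "taylor_coeff f 1 = 1" using starlike_conj_normalized[OF f] by (simp add: fps_expansion_def)
  have bound: "(\<Sum>n<N. norm (taylor_coeff f (n + 2)) * norm z ^ (n + 2)) \<le> H (norm z) - norm z" for N
  proof -
    have "(\<Sum>n\<le>N. norm (taylor_coeff f (Suc n)) * norm z ^ Suc n) = norm z + (\<Sum>n<N. norm (taylor_coeff f (n + 2)) * norm z ^ (n + 2))"
      unfolding lessThan_Suc_atMost[symmetric] by (subst sum.lessThan_Suc_shift) (use f1 in simp)
    then show ?thesis using partial_majorant_le_H[OF f norm_ge_zero z, of N] by linarith
  qed
  show s: "summable (\<lambda>n. norm (taylor_coeff f (n + 2)) * norm z ^ (n + 2))"
    by (rule summableI_nonneg_bounded[OF _ bound]) simp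
  show "bohr_sum f z \<le> H (norm z)"
    using suminf_le_const[OF s bound] by (simp add: bohr_sum_def)
qed

text \<open>
  The equation \<open>z h' = h \<phi>\<close> gives \<open>(n - 1) c_n\<close> as a combination of earlier coefficients with positive
  weights \<open>B k\<close>.
\<close>
lemma coeff_h:
  shows "Im (taylor_coeff h n) = 0" "Re (taylor_coeff h n) \<ge> 0"
proof -
  have h01: "taylor_coeff h 0 = 0" "taylor_coeff h 1 = 1" by (simp_all add: fps_expansion_def h_0 deriv_h_0)
  have "Im (taylor_coeff h n) = 0 \<and> Re (taylor_coeff h n) \<ge> 0"
  proof (induction n rule: less_induct)
    case (less n)
    consider "n = 0" | "n = 1" | m where "n = Suc (Suc m)" by (metis One_nat_def not0_implies_Suc)
    then show ?case
    proof cases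
      case 3
      have "of_nat n * taylor_coeff h n = (\<Sum>k\<le>n. taylor_coeff \<phi> k * taylor_coeff h (n - k))"
        by (rule coeff_of_mult_deriv_eq[OF hol_h hol_h hol_phi mult_deriv_h])
      also have "\<dots> = taylor_coeff h n + (\<Sum>k\<le>Suc m. of_real (B (Suc k)) * taylor_coeff h (Suc m - k))"
        unfolding 3 by (subst sum.atMost_Suc_shift) (simp add: fps_nth_phi)
      finally have "of_nat (Suc m) * taylor_coeff h n = (\<Sum>k\<le>Suc m. of_real (B (Suc k)) * taylor_coeff h (Suc m - k))"
        unfolding 3 by (simp only: of_nat_Suc[of "Suc m"] distrib_right mult_1 add_left_cancel)
      then have eq: "of_real (real (Suc m)) * taylor_coeff h n = (\<Sum>k\<le>Suc m. of_real (B (Suc k)) * taylor_coeff h (Suc m - k))"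
        by (simp only: of_real_of_nat_eq)
      have mult: "Im (of_real a * w) = a * Im w" "Re (of_real a * w) = a * Re w" for a w by simp_all
      have IH: "Im (taylor_coeff h (Suc m - k)) = 0" "Re (taylor_coeff h (Suc m - k)) \<ge> 0" for k
        using less[of "Suc m - k"] 3 by auto
      have "real (Suc m) * Im (taylor_coeff h n) = (\<Sum>k\<le>Suc m. B (Suc k) * Im (taylor_coeff h (Suc m - k)))"
        using arg_cong[OF eq, of Im] by (simp only: Im_sum mult)
      also have "\<dots> = 0" by (simp add: IH)
      finally have im: "Im (taylor_coeff h n) = 0" by (simp del: of_nat_Suc)
      have "real (Suc m) * Re (taylor_coeff h n) = (\<Sum>k\<le>Suc m. B (Suc k) * Re (taylor_coeff h (Suc m - k)))"
        using arg_cong[OF eq, of Re] by (simp only: Re_sum mult)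
      also have "\<dots> \<ge> 0" by (intro sum_nonneg mult_nonneg_nonneg less_imp_le[OF B_pos] IH) simp
      finally have "Re (taylor_coeff h n) \<ge> 0" by (simp add: zero_le_mult_iff del: of_nat_Suc)
      then show ?thesis using im by simp
    qed (use h01 in auto)
  qed
  then show "Im (taylor_coeff h n) = 0" "Re (taylor_coeff h n) \<ge> 0" by auto
qed

lemma bohr_sum_h:
  assumes z: "norm z < 1"
  shows "bohr_sum h z = H (norm z)"
proof -
  define r where "r = norm z"
  have r: "0 \<le> r" "r < 1" using z by (auto simp: r_def)
  have "h has_fps_expansion fps_expansion h 0"
    by (rule has_fps_expansion_fps_expansion[OF open_ball _ hol_h]) simp
  then have "(\<lambda>n. taylor_coeff h n * of_real r ^ n) sums h (of_real r)"
    by (rule has_fps_expansion_imp_sums_complex[where r = "ereal 1"]) (use hol_h r in auto)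
  then have "(\<lambda>n. Re (taylor_coeff h n * of_real r ^ n)) sums Re (h (of_real r))" by (rule sums_Re)
  moreover have "Re (taylor_coeff h n * of_real r ^ n) = norm (taylor_coeff h n) * r ^ n" for n
  proof -
    have "norm (taylor_coeff h n) = Re (taylor_coeff h n)" using coeff_h[of n] by (simp add: cmod_eq_Re)
    then show ?thesis by (simp add: of_real_power[symmetric] del: of_real_power)
  qed
  moreover have "Re (h (of_real r)) = H r" using h_of_real[of r] r by simp
  ultimately have "(\<lambda>n. norm (taylor_coeff h n) * r ^ n) sums H r" by (simp only:)
  moreover have "(\<Sum>n<2. norm (taylor_coeff h n) * r ^ n) = r"
    by (simp add: numeral_2_eq_2 fps_expansion_def h_0 deriv_h_0)
  ultimately have "(\<lambda>n. norm (taylor_coeff h (n + 2)) * r ^ (n + 2)) sums (H r - r)"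
    by (subst sums_iff_shift) simp
  then show ?thesis by (simp add: bohr_sum_def sums_iff r_def)
qed

lemma h_starlike_conj: "h \<in> starlike_conj \<phi>"
proof -
  have quot: "conj_quotient h z = \<phi> z" if z: "z \<in> ball 0 1" for z
  proof (cases "z = 0")
    case False
    have "cnj z \<in> ball 0 1" using z by simp
    have "cnj (G (cnj z)) = G z" using G_conj_mean[OF z] by (simp add: conj_mean_def)
    then have "cnj (h (cnj z)) = h z"
      using h_eq[OF z] h_eq[OF \<open>cnj z \<in> ball 0 1\<close>] by (simp add: exp_cnj)
    then show ?thesis
      using False mult_deriv_h[OF z] h_nonzero[OF z False] by (simp add: conj_quotient_def field_simps)
  qed (simp add: conj_quotient_def phi_0)
  have "conj_quotient h holomorphic_on ball 0 1"
    using holomorphic_transform[OF hol_phi, of "conj_quotient h"] quot by simp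
  then have "subordinate (conj_quotient h) \<phi>"
    unfolding subordinate_def using hol_phi quot by (intro conjI exI[of _ "\<lambda>z. z"]) auto
  then show ?thesis by (simp add: starlike_conj_def class_A_def hol_h h_0 deriv_h_0)
qed

text \<open>
  The point \<open>- L\<close> is the limit of \<open>h (- r)\<close> as \<open>r\<close> tends to \<open>1\<close>. It is not a value of \<open>h\<close>: the continuous
  inverse would otherwise carry this limit to a point of the open disc, whereas \<open>- r\<close> tends to \<open>- 1\<close>.
\<close>
lemma boundary_dist_h: "boundary_dist h = L"
proof (rule antisym)
  show "L \<le> boundary_dist h" by (rule L_le_boundary_dist[OF h_starlike_conj])
  have inj: "inj_on h (ball 0 1)" by (rule starlike_conj_inj_on[OF h_starlike_conj])
  have op: "open (h ` ball 0 1)" by (rule open_mapping_thm3[OF hol_h open_ball inj])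
  have ev: "\<forall>\<^sub>F r in at_left (1::real). - complex_of_real r \<in> ball 0 1"
    using eventually_at_left_real[of 0 "1::real", OF zero_less_one] by eventually_elim auto
  have "\<forall>\<^sub>F r in at_left (1::real). h (- of_real r) \<in> closure (h ` ball 0 1)"
    using ev by eventually_elim (meson closure_subset imageI subsetD)
  then have cl: "- complex_of_real L \<in> closure (h ` ball 0 1)"
    by (rule Lim_in_closed_set[OF closed_closure _ _ h_minus_tendsto]) simp
  have "- complex_of_real L \<notin> h ` ball 0 1"
  proof
    assume "- complex_of_real L \<in> h ` ball 0 1"
    then obtain z0 where z0: "z0 \<in> ball 0 1" "h z0 = - of_real L" by force
    obtain F where F: "F holomorphic_on h ` ball 0 1" "\<And>z. z \<in> ball 0 1 \<Longrightarrow> F (h z) = z"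
      using holomorphic_has_inverse[OF hol_h open_ball inj] by metis
    have "isCont F (h z0)"
      using F(1) op z0(1) by (meson continuous_on_eq_continuous_at holomorphic_on_imp_continuous_on imageI)
    then have "((\<lambda>r::real. F (h (- of_real r))) \<longlongrightarrow> F (h z0)) (at_left 1)"
      by (rule isCont_tendsto_compose) (use h_minus_tendsto z0 in simp)
    moreover have "\<forall>\<^sub>F r in at_left (1::real). F (h (- of_real r)) = - of_real r"
      using ev by eventually_elim (rule F(2))
    ultimately have "((\<lambda>r::real. - complex_of_real r) \<longlongrightarrow> F (h z0)) (at_left 1)"
      by (rule Lim_transform_eventually)
    then have "((\<lambda>r::real. - complex_of_real r) \<longlongrightarrow> z0) (at_left 1)" using F(2)[OF z0(1)] by simp
    moreover have "((\<lambda>r::real. - complex_of_real r) \<longlongrightarrow> - of_real 1) (at_left 1)"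
      by (intro tendsto_intros)
    ultimately have "z0 = - of_real 1" by (intro tendsto_unique[of "at_left (1::real)"]) auto
    then show False using z0 by simp
  qed
  then have "- complex_of_real L \<in> frontier (h ` ball 0 1)"
    using cl op by (simp add: frontier_def interior_open)
  then have "boundary_dist h \<le> dist 0 (- complex_of_real L)"
    unfolding boundary_dist_def h_0 by (rule infdist_le)
  then show "boundary_dist h \<le> L" using L_pos by simp
qed

end

section \<open>The Bohr inequality\<close>

theorem mainTheorem3:
  fixes \<phi> h :: "complex \<Rightarrow> complex" and B :: "nat \<Rightarrow> real"
  assumes "ma_minda \<phi>"
    and "\<And>z. z \<in> unit_disc \<Longrightarrow>
           (\<lambda>n. complex_of_real (B (Suc n)) * z ^ Suc n) sums (\<phi> z - 1)"
    and "\<And>n. n \<ge> 1 \<Longrightarrow> B n > 0"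
    and "\<And>r::real. 0 < r \<Longrightarrow> r < 1 \<Longrightarrow>
           complex_of_real (INF z\<in>sphere 0 r. norm (\<phi> z)) = \<phi> (- complex_of_real r)"
    and "\<And>r::real. 0 < r \<Longrightarrow> r < 1 \<Longrightarrow>
           complex_of_real (SUP z\<in>sphere 0 r. norm (\<phi> z)) = \<phi> (complex_of_real r)"
    and "ma_minda_extremal \<phi> h"
  shows "((\<lambda>r::real. h (- complex_of_real r)) \<longlongrightarrow> value_at_minus_one h) (at_left 1) \<and>
    (\<exists>!r. is_bohr_root h r) \<and>
    (\<forall>f \<in> starlike_conj \<phi>. \<forall>z. norm z \<le> min (1/3) (bohr_radius h) \<longrightarrow>
           summable (\<lambda>n. norm (taylor_coeff f (n + 2)) * norm z ^ (n + 2)) \<and>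
           bohr_sum f z \<le> boundary_dist f) \<and>
    (bohr_radius h \<le> 1/3 \<longrightarrow>
           (\<forall>R > bohr_radius h.
              \<not> (\<forall>f \<in> starlike_conj \<phi>. \<forall>z \<in> unit_disc. norm z \<le> R \<longrightarrow>
                    bohr_sum f z \<le> boundary_dist f)) \<and>
           h \<in> starlike_conj \<phi> \<and>
           (\<forall>z. norm z = bohr_radius h \<longrightarrow> bohr_sum h z = boundary_dist h) \<and>
           (\<forall>R > bohr_radius h. \<exists>z \<in> unit_disc. norm z \<le> R \<and>
              \<not> bohr_sum h z \<le> boundary_dist h))"
proof -
  interpret bohr_setting \<phi> h B
    using assms(1,2,3,4,6) by unfold_locales
  have lim: "((\<lambda>r::real. h (- complex_of_real r)) \<longlongrightarrow> value_at_minus_one h) (at_left 1)"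
    using h_minus_tendsto by (simp add: value_at_minus_one_h)
  have ineq: "summable (\<lambda>n. norm (taylor_coeff f (n + 2)) * norm z ^ (n + 2)) \<and> bohr_sum f z \<le> boundary_dist f"
    if f: "f \<in> starlike_conj \<phi>" and z: "norm z \<le> min (1/3) (bohr_radius h)" for f z
  proof -
    have z': "norm z \<le> 1/3" "norm z \<le> bohr_radius h" using z by auto
    have "bohr_sum f z \<le> H (norm z)" by (rule bohr_sum_le_H[OF f z'(1)])
    also have "\<dots> \<le> H (bohr_radius h)" using z'(2) bohr_radius_root by (intro H_mono) auto
    also have "\<dots> \<le> boundary_dist f" using bohr_radius_root L_le_boundary_dist[OF f] by simp
    finally show ?thesis using bohr_sum_le_H(1)[OF f z'(1)] by simp
  qed
  have sharp: "\<exists>z \<in> unit_disc. norm z \<le> R \<and> \<not> bohr_sum h z \<le> boundary_dist h"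
    if R: "R > bohr_radius h" for R
  proof -
    define r where "r = min R ((1 + bohr_radius h) / 2)"
    have r: "bohr_radius h < r" "r < 1" "r \<le> R" "0 < r"
      using R bohr_radius_root by (auto simp: r_def min_less_iff_disj)
    have "H (bohr_radius h) < H r" by (rule H_strict_mono) (use r bohr_radius_root in auto)
    then have "\<not> bohr_sum h (of_real r) \<le> boundary_dist h"
      using r bohr_radius_root by (simp add: bohr_sum_h boundary_dist_h)
    then show ?thesis using r by (intro bexI[of _ "of_real r"]) auto
  qed
  have eq: "bohr_sum h z = boundary_dist h" if "norm z = bohr_radius h" for z
    using that bohr_radius_root by (simp add: bohr_sum_h boundary_dist_h)
  have not_larger: "\<not> (\<forall>f \<in> starlike_conj \<phi>. \<forall>z \<in> unit_disc. norm z \<le> R \<longrightarrow> bohr_sum f z \<le> boundary_dist f)"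
    if R: "R > bohr_radius h" for R
  proof
    assume "\<forall>f \<in> starlike_conj \<phi>. \<forall>z \<in> unit_disc. norm z \<le> R \<longrightarrow> bohr_sum f z \<le> boundary_dist f"
    from bspec[OF this h_starlike_conj] sharp[OF R] show False by blast
  qed
  have main: "\<forall>f \<in> starlike_conj \<phi>. \<forall>z. norm z \<le> min (1/3) (bohr_radius h) \<longrightarrow>
      summable (\<lambda>n. norm (taylor_coeff f (n + 2)) * norm z ^ (n + 2)) \<and> bohr_sum f z \<le> boundary_dist f"
    by (intro ballI allI impI ineq)
  show ?thesis
    by (intro conjI impI allI lim ex1_bohr_root main not_larger h_starlike_conj eq sharp)
qed

end
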